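(* Let $V$ be a (finite-dimensional) real orthogonal representation of the finite group $G$, and let $k\geq 2$ be an integer. Then the algebra of invariants of the (diagonal) $G$-representation $V^k$ is generated by generalized polarizations; that is, $\mathbb{R}[V^k]^G=A^{(k)}$, where $A=\mathbb{R}[V]^G$.
   Context: For a finite-dimensional real inner product space $W$, $\mathbb{R}[W]$ denotes the algebra of real polynomial functions on $W$. In orthonormal coordinates $x_i$ on $W$, a sub-algebra of $\mathbb{R}[W]$ is called Laplacian if it contains $r^2=\sum_i x_i^2$ and is preserved by the Laplacian $\Delta=\sum_i\partial^2/\partial x_i^2$. $V^k$ carries the product inner product, and $G$ acts on $V^k$ diagonally. For a Laplacian sub-algebra $A\subset\mathbb{R}[V]$, the algebra of generalized polarizations $A^{(k)}\subset\mathbb{R}[V^k]$ is the smallest Laplacian sub-algebra of $\mathbb{R}[V^k]$ containing all polynomials $(v_1,\dots,v_k)\mapsto f(v_1)$ with $f\in A$, and all polynomials $(v_1,\dots,v_k)\mapsto\langle v_i,v_j\rangle$ with $1\le i,j\le k$. The algebra of invariants $\mathbb{R}[V]^G$ is a Laplacian algebra. *)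

theory Defs
  imports "HOL-Analysis.Analysis" "HOL-Algebra.Group_Action"
begin

text \<open>
  A finite-dimensional real inner product space is rendered as a type of class \<open>real_inner\<close> with a
  finite spanning set. The class \<open>euclidean_space\<close> is not used because it excludes the zero space.
  Polynomial functions are those of \<open>real_polynomial_function\<close>; on a finite-dimensional space every
  linear form is bounded, so these are exactly the polynomials in the coordinates.
\<close>

definition orthonormal_basis :: "'a::real_inner set \<Rightarrow> bool" where
  "orthonormal_basis B \<longleftrightarrow>
     finite B \<and> pairwise orthogonal B \<and> (\<forall>b\<in>B. norm b = 1) \<and> span B = UNIV"

definition partial_derivative :: "'a::real_inner \<Rightarrow> ('a \<Rightarrow> real) \<Rightarrow> 'a \<Rightarrow> real" where
  "partial_derivative b f x = deriv (\<lambda>t. f (x + t *\<^sub>R b)) 0"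

text \<open>
  On polynomial functions the value does not depend on the orthonormal basis chosen. Such a basis
  exists in the situations of interest, by the lemmas at the end.
\<close>

definition laplacian :: "('a::real_inner \<Rightarrow> real) \<Rightarrow> 'a \<Rightarrow> real" where
  "laplacian f x =
     (\<Sum>b\<in>(SOME B. orthonormal_basis B). partial_derivative b (partial_derivative b f) x)"

text \<open>
  Closure under scalar multiplication is a consequence of containing the constant functions and being
  closed under products.
\<close>

definition polynomial_subalgebra :: "('a::real_inner \<Rightarrow> real) set \<Rightarrow> bool" where
  "polynomial_subalgebra A \<longleftrightarrow>
     A \<subseteq> Collect real_polynomial_function \<and>
     (\<forall>c. (\<lambda>_. c) \<in> A) \<and>
     (\<forall>f\<in>A. \<forall>g\<in>A. (\<lambda>x. f x + g x) \<in> A) \<and>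
     (\<forall>f\<in>A. \<forall>g\<in>A. (\<lambda>x. f x * g x) \<in> A)"

definition laplacian_subalgebra :: "('a::real_inner \<Rightarrow> real) set \<Rightarrow> bool" where
  "laplacian_subalgebra A \<longleftrightarrow>
     polynomial_subalgebra A \<and> (\<lambda>x. (norm x)\<^sup>2) \<in> A \<and> (\<forall>f\<in>A. laplacian f \<in> A)"

text \<open>
  The space \<open>V\<^sup>k\<close> is the type \<open>'a ^ 'k\<close> with \<open>k = CARD('k)\<close>; its library inner product is the product
  inner product. The index \<open>i\<^sub>0\<close> plays the role of the first index. The hull is the intersection
  of all Laplacian sub-algebras containing the generators, and is itself one.
\<close>

definition generalized_polarizations ::
    "'k::finite \<Rightarrow> ('a::real_inner \<Rightarrow> real) set \<Rightarrow> ('a ^ 'k \<Rightarrow> real) set" where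
  "generalized_polarizations i\<^sub>0 A =
     laplacian_subalgebra hull
       ({(\<lambda>v. f (v $ i\<^sub>0)) | f. f \<in> A} \<union> {(\<lambda>v. (v $ i) \<bullet> (v $ j)) | i j. True})"

definition orthogonal_representation ::
    "('g, 'm) monoid_scheme \<Rightarrow> ('g \<Rightarrow> 'a::real_inner \<Rightarrow> 'a) \<Rightarrow> bool" where
  "orthogonal_representation G \<rho> \<longleftrightarrow>
     group_action G UNIV \<rho> \<and> (\<forall>g\<in>carrier G. orthogonal_transformation (\<rho> g))"

definition diagonal_action :: "('g \<Rightarrow> 'a \<Rightarrow> 'a) \<Rightarrow> 'g \<Rightarrow> 'a ^ 'k \<Rightarrow> 'a ^ 'k::finite" where
  "diagonal_action \<rho> g v = (\<chi> i. \<rho> g (v $ i))"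

definition invariant_polynomials ::
    "('g, 'm) monoid_scheme \<Rightarrow> ('g \<Rightarrow> 'a::real_inner \<Rightarrow> 'a) \<Rightarrow> ('a \<Rightarrow> real) set" where
  "invariant_polynomials G \<rho> =
     {f. real_polynomial_function f \<and> (\<forall>g\<in>carrier G. \<forall>x. f (\<rho> g x) = f x)}"

lemma orthonormal_basis_exists:
  assumes "\<exists>B :: 'a::real_inner set. finite B \<and> span B = UNIV"
  shows "\<exists>B :: 'a set. orthonormal_basis B"
proof -
  obtain B :: "'a set" where "finite B" "span B = UNIV"
    using assms by blast
  then obtain C :: "'a set" where C: "finite C" "span C = UNIV" "pairwise orthogonal C"
    using basis_orthogonal[of B] by auto
  define D where "D = (\<lambda>c. c /\<^sub>R norm c) ` (C - {0})"
  have "c \<in> span D" if "c \<in> C" for c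
  proof (cases "c = 0")
    case False
    then have "c /\<^sub>R norm c \<in> span D"
      using that by (auto simp: D_def intro: span_base)
    then have "norm c *\<^sub>R (c /\<^sub>R norm c) \<in> span D"
      by (rule span_scale)
    then show ?thesis
      using False by simp
  qed (simp add: span_zero)
  then have "span C \<subseteq> span D"
    by (intro span_minimal) auto
  then have "span D = UNIV"
    using C(2) by auto
  moreover have "pairwise orthogonal D"
    using C(3) unfolding D_def pairwise_def by (auto simp: orthogonal_def)
  ultimately show ?thesis
    using C(1) unfolding orthonormal_basis_def
    by (intro exI[of _ D]) (auto simp: D_def)
qed

lemma orthonormal_basis_exists_vec:
  assumes "\<exists>B :: 'a::real_inner set. finite B \<and> span B = UNIV"
  shows "\<exists>B :: ('a ^ 'k::finite) set. orthonormal_basis B"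
proof (rule orthonormal_basis_exists)
  obtain B :: "'a set" where B: "finite B" "span B = UNIV"
    using assms by blast
  define C :: "('a ^ 'k) set" where "C = (\<Union>i. axis i ` B)"
  have ax: "axis i x \<in> span C" for i x
  proof -
    have lin: "linear (axis i :: 'a \<Rightarrow> 'a ^ 'k)"
      by (rule linearI) (auto simp: vec_eq_iff axis_def)
    have "span (axis i ` B) = range (axis i :: 'a \<Rightarrow> 'a ^ 'k)"
      using B(2) linear_span_image[OF lin, of B] by simp
    moreover have "span (axis i ` B) \<subseteq> span C"
      by (rule span_mono) (auto simp: C_def)
    ultimately show ?thesis
      by blast
  qed
  have "v \<in> span C" for v
  proof -
    have "v = (\<Sum>i\<in>UNIV. axis i (v $ i))"
      by (simp add: vec_eq_iff axis_def)
    also have "\<dots> \<in> span C"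
      by (intro span_sum ax)
    finally show ?thesis .
  qed
  moreover have "finite C"
    using B(1) by (simp add: C_def)
  ultimately show "\<exists>B :: ('a ^ 'k) set. finite B \<and> span B = UNIV"
    by blast
qed

end

theory Submission
  imports Defs
begin

text \<open>
  The inclusion of the generalized polarizations in the invariants is formal: the Laplacian commutes
  with orthogonal maps, so the invariants of the diagonal action are themselves a Laplacian
  subalgebra, and they contain the generators. For the converse let \<open>T\<close> be the algebra of
  generalized polarizations. Two facts combine.

  First, \<open>T\<close> has enough elements that every invariant \<open>h\<close> of \<open>V\<^sup>k\<close> is a quotient of two elements of
  \<open>T\<close>. The identity \<open>\<Delta>(f g) = f \<Delta> g + g \<Delta> f + 2 \<langle>\<nabla>f, \<nabla>g\<rangle>\<close> shows that a Laplacian subalgebra is closed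
  under pairing gradients, and pairing \<open>f (v\<^sub>i)\<close> with \<open>\<langle>v\<^sub>i, v\<^sub>j\<rangle>\<close> gives the first polarization
  \<open>\<langle>\<nabla>f (v\<^sub>i), v\<^sub>j\<rangle>\<close> (\<open>polarization_closed\<close>). Applied to the power sums of a linear form \<open>\<theta>\<close> over its
  orbit, this puts all \<open>\<Sum>\<^sub>g \<theta>(g v\<^sub>i)\<^sup>m \<theta>(g v\<^sub>j)\<close> in \<open>T\<close>. Lagrange interpolation at the nodes \<open>\<theta>(g v\<^sub>i)\<close>
  isolates the summand of the identity element: some nonzero polynomial in \<open>v\<^sub>i\<close> times \<open>\<theta>(v\<^sub>j)\<close>
  is a combination of elements of \<open>T\<close> whose coefficients are polynomials in \<open>v\<^sub>i\<close>
  (\<open>linear_form_clearable\<close>). Since linear forms generate all polynomials, every polynomial has this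
  property, and for an invariant \<open>h\<close> averaging over the group turns the coefficients into invariants
  of \<open>v\<^sub>i\<close>, which lie in \<open>T\<close>.

  Secondly, a Laplacian subalgebra contains every polynomial \<open>h\<close> that is a quotient of two of its
  elements (\<open>laplacian_subalgebra_contains_quotients\<close>). Consider the inner product
  \<open>\<langle>f, g\<rangle> = E(f g)\<close>, where \<open>E\<close> is the expectation under the standard Gaussian measure. Multiplication by
  an element of \<open>T\<close> is symmetric, so it preserves the orthogonal complement of \<open>T\<close>. If
  \<open>h = s + m\<close> with \<open>s \<in> T\<close> and \<open>m\<close> orthogonal to \<open>T\<close>, and \<open>b\<close> and \<open>b h\<close> are in \<open>T\<close> with \<open>b \<noteq> 0\<close>, then \<open>b m\<close> both
  lies in \<open>T\<close> and is orthogonal to \<open>T\<close>. Hence \<open>b m = 0\<close>, and so \<open>m = 0\<close>.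

  The decomposition \<open>h = s + m\<close> is where closure under the Laplacian is decisive, because \<open>T\<close> is
  infinite-dimensional in general. The number operator \<open>N = x \<bullet> \<nabla> - \<Delta>\<close> is symmetric for the Gaussian
  inner product, preserves \<open>T\<close>, and has eigenvalues \<open>0, 1, 2, \<dots>\<close> that refine the degree filtration.
  Elements of \<open>T\<close> of high degree therefore split inside \<open>T\<close> into eigenfunctions orthogonal to all
  polynomials of lower degree, and it suffices to project \<open>h\<close> onto the finite-dimensional part of \<open>T\<close>
  of degree at most that of \<open>h\<close>. The functional \<open>E\<close> is handled algebraically, as
  \<open>f \<mapsto> (exp(\<Delta>/2) f)(0)\<close>, and the splitting into eigenfunctions also proves that it is positive definite.
\<close>

section \<open>Differentiation of polynomial functions\<close>

notation partial_derivative (\<open>\<partial>\<close>)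

abbreviation poly_fun :: "('a::real_normed_vector \<Rightarrow> real) \<Rightarrow> bool" where
  "poly_fun \<equiv> real_polynomial_function"

lemma poly_fun_inner [simp]: "poly_fun (\<lambda>x. x \<bullet> u)"
  by (intro real_polynomial_function.intros(1) bounded_linear_inner_left)

lemma poly_fun_inner' [simp]: "poly_fun (\<lambda>x. u \<bullet> x)"
  by (intro real_polynomial_function.intros(1) bounded_linear_inner_right)

lemmas poly_fun_intros [simp, intro] =
  real_polynomial_function.intros(2-)
  real_polynomial_function_minus real_polynomial_function_diff real_polynomial_function_sum
  real_polynomial_function_prod real_polynomial_function_power

lemma poly_fun_compose_bounded_linear:
  assumes "poly_fun f" "bounded_linear L"
  shows "poly_fun (\<lambda>x. f (L x))"
  using real_polynomial_function_compose[OF polynomial_function_bounded_linear[OF assms(2)] assms(1)]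
  by (simp add: o_def)

lemma partial_derivative_eqI:
  assumes "((\<lambda>t. f (x + t *\<^sub>R u)) has_real_derivative d) (at 0)"
  shows "\<partial> u f x = d"
  unfolding partial_derivative_def using assms by (rule DERIV_imp_deriv)

lemma has_derivative_linear_along_line:
  assumes "bounded_linear f"
  shows "((\<lambda>t. f (x + t *\<^sub>R u)) has_real_derivative f u) (at t)"
proof -
  interpret bounded_linear f by fact
  have "((\<lambda>t. f x + t * f u) has_real_derivative f u) (at t)"
    by (auto intro!: derivative_eq_intros)
  then show ?thesis
    by (simp add: add scaleR)
qed

lemma poly_fun_has_partial_derivative:
  assumes "poly_fun f"
  shows "((\<lambda>t. f (x + t *\<^sub>R u)) has_real_derivative \<partial> u f x) (at 0)"
  using assms
proof (induction f rule: real_polynomial_function.induct)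
  case (linear f)
  from has_derivative_linear_along_line[OF this] show ?case
    using partial_derivative_eqI by metis
next
  case (const c)
  have "((\<lambda>t. c) has_real_derivative 0) (at 0)" by simp
  then show ?case
    using partial_derivative_eqI[of "\<lambda>_. c"] by metis
next
  case (add f g)
  note DERIV_add[OF this(3,4)]
  from this partial_derivative_eqI[OF this] show ?case by simp
next
  case (mult f g)
  note DERIV_mult[OF this(3,4)]
  from this partial_derivative_eqI[OF this] show ?case by simp
qed

lemma partial_derivative_linear:
  "bounded_linear f \<Longrightarrow> \<partial> u f = (\<lambda>x. f u)"
  by (intro ext partial_derivative_eqI has_derivative_linear_along_line)

lemma partial_derivative_inner [simp]: "\<partial> u (\<lambda>x. x \<bullet> v) = (\<lambda>x. u \<bullet> v)"
  by (intro partial_derivative_linear bounded_linear_inner_left)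

lemma partial_derivative_const [simp]: "\<partial> u (\<lambda>x. c) = (\<lambda>x. 0)"
  by (intro ext partial_derivative_eqI) simp

lemma partial_derivative_add [simp]:
  assumes "poly_fun f" "poly_fun g"
  shows "\<partial> u (\<lambda>x. f x + g x) = (\<lambda>x. \<partial> u f x + \<partial> u g x)"
  by (intro ext partial_derivative_eqI DERIV_add poly_fun_has_partial_derivative assms)

lemma partial_derivative_mult [simp]:
  assumes "poly_fun f" "poly_fun g"
  shows "\<partial> u (\<lambda>x. f x * g x) = (\<lambda>x. \<partial> u f x * g x + f x * \<partial> u g x)"
proof (intro ext partial_derivative_eqI)
  fix x
  show "((\<lambda>t. f (x + t *\<^sub>R u) * g (x + t *\<^sub>R u)) has_real_derivative
          \<partial> u f x * g x + f x * \<partial> u g x) (at 0)"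
    using DERIV_mult[OF assms[THEN poly_fun_has_partial_derivative]]
    by (simp add: mult.commute)
qed

lemma poly_fun_partial_derivative [simp, intro]:
  assumes "poly_fun f"
  shows "poly_fun (\<partial> u f)"
  using assms
  by (induction f rule: real_polynomial_function.induct) (simp_all add: partial_derivative_linear)

lemma partial_derivative_diff [simp]:
  assumes "poly_fun f" "poly_fun g"
  shows "\<partial> u (\<lambda>x. f x - g x) = (\<lambda>x. \<partial> u f x - \<partial> u g x)"
  by (intro ext partial_derivative_eqI DERIV_diff poly_fun_has_partial_derivative assms)

lemma partial_derivative_sum [simp]:
  assumes "\<And>i. i \<in> I \<Longrightarrow> poly_fun (f i)"
  shows "\<partial> u (\<lambda>x. \<Sum>i\<in>I. f i x) = (\<lambda>x. \<Sum>i\<in>I. \<partial> u (f i) x)"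
  using assms by (intro ext partial_derivative_eqI DERIV_sum poly_fun_has_partial_derivative) auto

lemma partial_derivative_add_direction:
  assumes "poly_fun f"
  shows "\<partial> (u + v) f x = \<partial> u f x + \<partial> v f x"
  using assms
proof (induction f rule: real_polynomial_function.induct)
  case (linear f)
  then show ?case
    by (simp add: partial_derivative_linear linear_add bounded_linear.linear)
qed (simp_all add: algebra_simps)

lemma partial_derivative_scale_direction:
  assumes "poly_fun f"
  shows "\<partial> (c *\<^sub>R u) f x = c * \<partial> u f x"
  using assms
proof (induction f rule: real_polynomial_function.induct)
  case (linear f)
  then show ?case
    by (simp add: partial_derivative_linear linear_scale bounded_linear.linear)
qed (simp_all add: algebra_simps)

lemma partial_derivative_sum_direction:
  assumes "poly_fun f"
  shows "\<partial> (\<Sum>i\<in>I. c i *\<^sub>R u i) f x = (\<Sum>i\<in>I. c i * \<partial> (u i) f x)"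
proof -
  have "linear (\<lambda>u. \<partial> u f x)"
    by (rule linearI)
      (simp_all add: assms partial_derivative_add_direction partial_derivative_scale_direction)
  from linear_sum[OF this, of "\<lambda>i. c i *\<^sub>R u i" I] show ?thesis
    by (simp add: partial_derivative_scale_direction[OF assms])
qed

lemma partial_derivative_commute:
  assumes "poly_fun f"
  shows "\<partial> u (\<partial> v f) = \<partial> v (\<partial> u f)"
  using assms
  by (induction f rule: real_polynomial_function.induct)
    (simp_all add: partial_derivative_linear algebra_simps)

lemma partial_derivative_compose_linear:
  assumes "linear L"
  shows "\<partial> u (\<lambda>x. f (L x)) = (\<lambda>x. \<partial> (L u) f (L x))"
  by (simp add: fun_eq_iff partial_derivative_def linear_add[OF assms] linear_scale[OF assms])

text \<open>
  Along each ray from the origin the derivative is zero.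
\<close>

lemma poly_fun_constant_if_derivatives_vanish:
  assumes "poly_fun f" "\<And>u. \<partial> u f = (\<lambda>x. 0)"
  shows "f = (\<lambda>x. f 0)"
proof
  fix x
  have "((\<lambda>t. f (t *\<^sub>R x)) has_real_derivative 0) (at s)" for s
  proof -
    have "((\<lambda>t. f (s *\<^sub>R x + t *\<^sub>R x)) has_real_derivative 0) (at 0)"
      using poly_fun_has_partial_derivative[OF assms(1), of "s *\<^sub>R x" x] by (simp add: assms(2))
    then show ?thesis
      using DERIV_shift[of "\<lambda>t. f (t *\<^sub>R x)" 0 0 s] by (simp add: algebra_simps)
  qed
  then show "f x = f 0"
    using DERIV_isconst_all[of "\<lambda>t. f (t *\<^sub>R x)" 1 0] by simp
qed

lemma poly_fun_along_line:
  assumes "poly_fun f"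
  shows "poly_fun (\<lambda>t::real. f (x + t *\<^sub>R u))"
proof -
  have "polynomial_function (\<lambda>t::real. x + t *\<^sub>R u)"
    by (intro polynomial_function_add polynomial_function_mult)
      (auto intro: polynomial_function_bounded_linear)
  from real_polynomial_function_compose[OF this assms] show ?thesis
    by (simp add: o_def)
qed

lemma poly_fun_real_finite_zeros:
  fixes f :: "real \<Rightarrow> real"
  assumes "poly_fun f" "f y \<noteq> 0"
  shows "finite {t. f t = 0}"
proof -
  obtain a n where f: "f = (\<lambda>x. \<Sum>i\<le>n. a i * x ^ i)"
    using assms(1) unfolding real_polynomial_function_iff_sum by blast
  have "\<exists>i\<le>n. a i \<noteq> 0"
    using assms(2) unfolding f by (auto intro: ccontr)
  then show ?thesis
    unfolding f by (simp add: polyfun_finite_roots)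
qed

text \<open>
  Points \<open>x\<close> and \<open>y\<close> at which the two factors do not vanish lie on a common line, and on that line
  either factor has only finitely many zeros.
\<close>

lemma poly_fun_no_zero_divisors:
  assumes "poly_fun f" "poly_fun g" "f x \<noteq> 0" "g y \<noteq> 0"
  shows "\<exists>z. f z * g z \<noteq> 0"
proof -
  let ?l = "\<lambda>t::real. x + t *\<^sub>R (y - x)"
  have "finite {t. f (?l t) = 0}"
    using poly_fun_real_finite_zeros[OF poly_fun_along_line[OF assms(1)], of x 0] assms(3) by simp
  moreover have "finite {t. g (?l t) = 0}"
    using poly_fun_real_finite_zeros[OF poly_fun_along_line[OF assms(2)], of x 1] assms(4) by simp
  ultimately have "finite ({t. f (?l t) = 0} \<union> {t. g (?l t) = 0})"
    by simp
  then obtain t where "t \<notin> {t. f (?l t) = 0} \<union> {t. g (?l t) = 0}"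
    using ex_new_if_finite infinite_UNIV_char_0 by blast
  then show ?thesis
    by auto
qed

lemma poly_fun_prod_nonzero:
  assumes "finite I" "\<And>i. i \<in> I \<Longrightarrow> poly_fun (f i)" "\<And>i. i \<in> I \<Longrightarrow> \<exists>x. f i x \<noteq> 0"
  shows "\<exists>x. (\<Prod>i\<in>I. f i x) \<noteq> 0"
  using assms
proof (induction I rule: finite_induct)
  case (insert i I)
  then have "\<exists>x. f i x \<noteq> 0" "\<exists>y. (\<Prod>j\<in>I. f j y) \<noteq> 0"
    by simp_all
  then obtain x y where "f i x \<noteq> 0" "(\<Prod>j\<in>I. f j y) \<noteq> 0"
    by blast
  then have "\<exists>z. f i z * (\<Prod>j\<in>I. f j z) \<noteq> 0"
    using insert by (intro poly_fun_no_zero_divisors) auto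
  then show ?case
    using insert by simp
qed simp

section \<open>The Laplacian and the Euler field in orthonormal coordinates\<close>

context
  fixes B :: "'a::real_inner set"
  assumes B: "orthonormal_basis B"
begin

lemma finite_basis [simp]: "finite B"
  using B by (simp add: orthonormal_basis_def)

lemma orthonormal_expansion: "(\<Sum>b\<in>B. (x \<bullet> b) *\<^sub>R b) = x"
  using B unfolding orthonormal_basis_def by (intro orthonormal_basis_expand) auto

lemma parseval: "(\<Sum>b\<in>B. (b \<bullet> x) * (b \<bullet> y)) = x \<bullet> y"
proof -
  have "(\<Sum>b\<in>B. (b \<bullet> x) * (b \<bullet> y)) = (\<Sum>b\<in>B. (x \<bullet> b) *\<^sub>R b) \<bullet> y"
    unfolding inner_sum_left by (simp add: inner_commute)
  then show ?thesis
    by (simp only: orthonormal_expansion)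
qed

lemma bounded_linear_if_linear:
  assumes "linear (h :: 'a \<Rightarrow> real)"
  shows "bounded_linear h"
proof -
  have "h x = (\<Sum>b\<in>B. (x \<bullet> b) * h b)" for x
    using linear_sum[OF assms, of "\<lambda>b. (x \<bullet> b) *\<^sub>R b" B]
    by (simp add: orthonormal_expansion linear_scale[OF assms])
  then have h: "h = (\<lambda>x. \<Sum>b\<in>B. (x \<bullet> b) * h b)"
    by blast
  show ?thesis
    by (subst h) (intro bounded_linear_sum bounded_linear_mult_const bounded_linear_inner_left)
qed

lemma partial_derivative_expand:
  assumes "poly_fun f"
  shows "\<partial> u f x = (\<Sum>b\<in>B. (u \<bullet> b) * \<partial> b f x)"
  using partial_derivative_sum_direction[OF assms, of "\<lambda>b. u \<bullet> b" "\<lambda>b. b" B x]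
  by (simp add: orthonormal_expansion)

end

context
  fixes B :: "'a::real_inner set"
  assumes B: "orthonormal_basis B"
begin

lemmas [simp] = finite_basis[OF B]

text \<open>
  Both sides are the trace of the bilinear form \<open>(u, v) \<mapsto> \<partial> u (\<partial> v f) x\<close>. The right-hand side does not
  mention \<open>E\<close>, so the sum agrees for any two orthonormal bases.
\<close>

lemma sum_second_derivatives_independent_of_basis:
  assumes "poly_fun f" "orthonormal_basis E"
  shows "(\<Sum>e\<in>E. \<partial> e (\<partial> e f) x) = (\<Sum>b\<in>B. \<Sum>c\<in>B. (b \<bullet> c) * \<partial> c (\<partial> b f) x)"
proof -
  have "\<partial> e (\<partial> e f) x = (\<Sum>b\<in>B. \<Sum>c\<in>B. (e \<bullet> b) * (e \<bullet> c) * \<partial> c (\<partial> b f) x)" for e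
  proof -
    have "\<partial> e f = (\<lambda>x. \<Sum>b\<in>B. (e \<bullet> b) * \<partial> b f x)"
      using partial_derivative_expand[OF B assms(1)] by blast
    then have "\<partial> e (\<partial> e f) x = (\<Sum>b\<in>B. (e \<bullet> b) * \<partial> e (\<partial> b f) x)"
      using assms(1) by simp
    also have "\<dots> = (\<Sum>b\<in>B. (e \<bullet> b) * (\<Sum>c\<in>B. (e \<bullet> c) * \<partial> c (\<partial> b f) x))"
      by (simp add: partial_derivative_expand[OF B, of "\<partial> _ f" e] assms(1))
    finally show ?thesis
      by (simp add: sum_distrib_left mult.assoc)
  qed
  then have "(\<Sum>e\<in>E. \<partial> e (\<partial> e f) x)
      = (\<Sum>e\<in>E. \<Sum>b\<in>B. \<Sum>c\<in>B. (e \<bullet> b) * (e \<bullet> c) * \<partial> c (\<partial> b f) x)"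
    by simp
  also have "\<dots> = (\<Sum>b\<in>B. \<Sum>e\<in>E. \<Sum>c\<in>B. (e \<bullet> b) * (e \<bullet> c) * \<partial> c (\<partial> b f) x)"
    by (rule sum.swap)
  also have "\<dots> = (\<Sum>b\<in>B. \<Sum>c\<in>B. \<Sum>e\<in>E. (e \<bullet> b) * (e \<bullet> c) * \<partial> c (\<partial> b f) x)"
    by (intro sum.cong refl sum.swap)
  also have "\<dots> = (\<Sum>b\<in>B. \<Sum>c\<in>B. (\<Sum>e\<in>E. (e \<bullet> b) * (e \<bullet> c)) * \<partial> c (\<partial> b f) x)"
    by (simp add: sum_distrib_right)
  finally show ?thesis
    by (simp add: parseval[OF assms(2)])
qed

lemma laplacian_eq:
  assumes "poly_fun f"
  shows "laplacian f = (\<lambda>x. \<Sum>b\<in>B. \<partial> b (\<partial> b f) x)"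
proof
  fix x
  have "orthonormal_basis (SOME E :: 'a set. orthonormal_basis E)"
    using B by (rule someI)
  from sum_second_derivatives_independent_of_basis[OF assms this]
  show "laplacian f x = (\<Sum>b\<in>B. \<partial> b (\<partial> b f) x)"
    using sum_second_derivatives_independent_of_basis[OF assms B] by (simp add: laplacian_def)
qed

lemma poly_fun_laplacian:
  fixes f :: "'a \<Rightarrow> real"
  assumes "poly_fun f"
  shows "poly_fun (laplacian f)"
  using assms by (simp add: laplacian_eq)

lemma laplacian_add:
  fixes f g :: "'a \<Rightarrow> real"
  assumes "poly_fun f" "poly_fun g"
  shows "laplacian (\<lambda>x. f x + g x) = (\<lambda>x. laplacian f x + laplacian g x)"
  using assms by (simp add: laplacian_eq sum.distrib)

lemma laplacian_diff:
  fixes f g :: "'a \<Rightarrow> real"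
  assumes "poly_fun f" "poly_fun g"
  shows "laplacian (\<lambda>x. f x - g x) = (\<lambda>x. laplacian f x - laplacian g x)"
  using assms by (simp add: laplacian_eq sum_subtractf)

lemma laplacian_const: "laplacian (\<lambda>x::'a. c) = (\<lambda>x. 0)"
  by (simp add: laplacian_eq)

lemma laplacian_cmult:
  fixes f :: "'a \<Rightarrow> real"
  assumes "poly_fun f"
  shows "laplacian (\<lambda>x. c * f x) = (\<lambda>x. c * laplacian f x)"
  using assms by (simp add: laplacian_eq sum_distrib_left)

text \<open>
  The cross term is how a Laplacian subalgebra gains access to first derivatives.
\<close>

lemma laplacian_mult:
  fixes f g :: "'a \<Rightarrow> real"
  assumes "poly_fun f" "poly_fun g"
  shows "laplacian (\<lambda>x. f x * g x) =
    (\<lambda>x. f x * laplacian g x + g x * laplacian f x + 2 * (\<Sum>b\<in>B. \<partial> b f x * \<partial> b g x))"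
  using assms by (simp add: laplacian_eq sum.distrib sum_distrib_left algebra_simps)

lemma laplacian_inner_mult:
  fixes f :: "'a \<Rightarrow> real"
  assumes "poly_fun f"
  shows "laplacian (\<lambda>x. (x \<bullet> u) * f x) = (\<lambda>x. (x \<bullet> u) * laplacian f x + 2 * \<partial> u f x)"
proof -
  have "(\<Sum>b\<in>B. (b \<bullet> u) * \<partial> b f x) = \<partial> u f x" for x
    by (simp add: partial_derivative_expand[OF B assms, of u] inner_commute)
  moreover have "laplacian (\<lambda>x. x \<bullet> u) = (\<lambda>x. 0)"
    by (simp add: laplacian_eq)
  ultimately show ?thesis
    using assms by (simp add: laplacian_mult)
qed

lemma partial_derivative_laplacian:
  fixes f :: "'a \<Rightarrow> real"
  assumes "poly_fun f"
  shows "\<partial> u (laplacian f) = laplacian (\<partial> u f)"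
  using assms by (simp add: laplacian_eq partial_derivative_commute[of _ u])

text \<open>
  The expression \<open>\<partial> x f x\<close>, the derivative at \<open>x\<close> in the direction of \<open>x\<close> itself, is the Euler
  field applied to \<open>f\<close>.
\<close>

lemma euler_eq:
  fixes f :: "'a \<Rightarrow> real"
  assumes "poly_fun f"
  shows "(\<lambda>x. \<partial> x f x) = (\<lambda>x. \<Sum>b\<in>B. (x \<bullet> b) * \<partial> b f x)"
  using partial_derivative_expand[OF B assms] by blast

lemma poly_fun_euler:
  fixes f :: "'a \<Rightarrow> real"
  assumes "poly_fun f"
  shows "poly_fun (\<lambda>x. \<partial> x f x)"
  using assms by (simp add: euler_eq)

lemma partial_derivative_euler:
  fixes f :: "'a \<Rightarrow> real"
  assumes "poly_fun f"
  shows "\<partial> u (\<lambda>x. \<partial> x f x) = (\<lambda>x. \<partial> u f x + \<partial> x (\<partial> u f) x)"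
proof
  fix x
  have "\<partial> u (\<lambda>x. \<partial> x f x) x
      = (\<Sum>b\<in>B. (u \<bullet> b) * \<partial> b f x) + (\<Sum>b\<in>B. (x \<bullet> b) * \<partial> b (\<partial> u f) x)"
    using assms
    by (simp add: euler_eq sum.distrib partial_derivative_commute[of _ u])
  also have "\<dots> = \<partial> u f x + \<partial> x (\<partial> u f) x"
    using assms by (simp add: partial_derivative_expand[OF B, symmetric])
  finally show "\<partial> u (\<lambda>x. \<partial> x f x) x = \<partial> u f x + \<partial> x (\<partial> u f) x" .
qed

end

section \<open>The degree filtration\<close>

text \<open>
  The degree is measured by the number of derivatives that make the polynomial constant, so that
  induction on the degree needs no monomials and no choice of coordinates.
\<close>

primrec degree_le :: "nat \<Rightarrow> ('a::real_inner \<Rightarrow> real) \<Rightarrow> bool" where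
  "degree_le 0 f \<longleftrightarrow> (\<exists>c. f = (\<lambda>_. c))"
| "degree_le (Suc d) f \<longleftrightarrow> poly_fun f \<and> (\<forall>u. degree_le d (\<partial> u f))"

lemma poly_fun_if_degree_le: "degree_le d f \<Longrightarrow> poly_fun f"
  by (cases d) auto

lemma degree_le_const [simp]: "degree_le d (\<lambda>x. c)"
  by (induction d arbitrary: c) auto

lemma degree_le_Suc: "degree_le d f \<Longrightarrow> degree_le (Suc d) f"
  by (induction d arbitrary: f) auto

lemma degree_le_partial_derivative:
  assumes "degree_le d f"
  shows "degree_le d (\<partial> u f)"
proof (cases d)
  case 0
  then show ?thesis
    using assms by auto
next
  case (Suc n)
  then have "degree_le n (\<partial> u f)"
    using assms by simp
  then show ?thesis
    unfolding Suc by (rule degree_le_Suc)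
qed

lemma degree_le_mono: "d \<le> e \<Longrightarrow> degree_le d f \<Longrightarrow> degree_le e f"
  by (induction e rule: dec_induct) (auto simp del: degree_le.simps intro: degree_le_Suc)

lemma degree_le_add:
  "degree_le d f \<Longrightarrow> degree_le d g \<Longrightarrow> degree_le d (\<lambda>x. f x + g x)"
  by (induction d arbitrary: f g) auto

lemma degree_le_cmult: "degree_le d f \<Longrightarrow> degree_le d (\<lambda>x. c * f x)"
  by (induction d arbitrary: f) auto

lemma degree_le_diff:
  assumes "degree_le d f" "degree_le d g"
  shows "degree_le d (\<lambda>x. f x - g x)"
  using degree_le_add[OF assms(1) degree_le_cmult[OF assms(2), of "-1"]] by simp

lemma degree_le_sum:
  assumes "finite I" "\<And>i. i \<in> I \<Longrightarrow> degree_le d (f i)"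
  shows "degree_le d (\<lambda>x. \<Sum>i\<in>I. f i x)"
  using assms by (induction I rule: finite_induct) (auto intro: degree_le_add)

lemma degree_le_mult:
  "degree_le d f \<Longrightarrow> degree_le e g \<Longrightarrow> degree_le (d + e) (\<lambda>x. f x * g x)"
proof (induction "d + e" arbitrary: d e f g rule: less_induct)
  case less
  consider "d = 0" | "e = 0" | d' e' where "d = Suc d'" "e = Suc e'"
    by (cases d; cases e) auto
  then show ?case
  proof cases
    case 1
    with less.prems show ?thesis
      by (auto intro: degree_le_cmult)
  next
    case 2
    then obtain c where "g = (\<lambda>_. c)"
      using less.prems(2) by auto
    with 2 less.prems(1) degree_le_cmult[of d f c] show ?thesis
      by (simp add: mult.commute)
  next
    case 3
    have pf: "poly_fun f" "poly_fun g" "\<And>u. degree_le d' (\<partial> u f)" "\<And>u. degree_le e' (\<partial> u g)"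
      using less.prems 3 by auto
    have "degree_le (d' + Suc e') (\<lambda>x. \<partial> u f x * g x)" for u
      using less.prems 3 pf by (intro less.hyps) auto
    moreover have "degree_le (Suc d' + e') (\<lambda>x. f x * \<partial> u g x)" for u
      using less.prems 3 pf by (intro less.hyps) auto
    ultimately have "degree_le (Suc (d' + e')) (\<lambda>x. \<partial> u f x * g x + f x * \<partial> u g x)" for u
      by (intro degree_le_add) (simp_all del: degree_le.simps)
    then have "degree_le (Suc (Suc (d' + e'))) (\<lambda>x. f x * g x)"
      using pf by (subst degree_le.simps) (simp del: degree_le.simps)
    then show ?thesis
      using 3 by simp
  qed
qed

lemma poly_fun_has_degree:
  assumes "poly_fun f"
  shows "\<exists>d. degree_le d f"
  using assms
proof (induction f rule: real_polynomial_function.induct)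
  case (linear f)
  then have "degree_le 1 f"
    by (simp add: partial_derivative_linear real_polynomial_function.intros(1))
  then show ?case ..
next
  case (const c)
  then show ?case
    using degree_le_const by blast
next
  case (add f g)
  then obtain d e where "degree_le d f" "degree_le e g"
    by blast
  then have "degree_le (max d e) f" "degree_le (max d e) g"
    by (auto intro: degree_le_mono[rotated])
  then show ?case
    using degree_le_add by blast
next
  case (mult f g)
  then show ?case
    using degree_le_mult by blast
qed

lemma degree_le_laplacian:
  fixes f :: "'a::real_inner \<Rightarrow> real"
  assumes "orthonormal_basis (B :: 'a set)" "degree_le (Suc d) f"
  shows "degree_le d (laplacian f)"
proof -
  have "degree_le d (\<partial> b (\<partial> b f))" for b
    using assms(2) degree_le_partial_derivative by auto
  then show ?thesis
    using assms finite_basis[OF assms(1)]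
    by (simp add: laplacian_eq degree_le_sum)
qed

section \<open>The number operator\<close>

text \<open>
  This is the negative of the generator of the Ornstein-Uhlenbeck semigroup. Its eigenspaces
  are spanned by products of Hermite polynomials, with the degree as eigenvalue.
\<close>

definition number_operator :: "('a::real_inner \<Rightarrow> real) \<Rightarrow> 'a \<Rightarrow> real" where
  "number_operator f x = \<partial> x f x - laplacian f x"

context
  fixes B :: "'a::real_inner set"
  assumes B: "orthonormal_basis B"
begin

lemma number_operator_eq:
  fixes f :: "'a \<Rightarrow> real"
  assumes "poly_fun f"
  shows "number_operator f = (\<lambda>x. \<Sum>b\<in>B. (x \<bullet> b) * \<partial> b f x - \<partial> b (\<partial> b f) x)"
proof
  fix x
  have "\<partial> x f x = (\<Sum>b\<in>B. (x \<bullet> b) * \<partial> b f x)"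
    using fun_cong[OF euler_eq[OF B assms], of x] .
  then show "number_operator f x = (\<Sum>b\<in>B. (x \<bullet> b) * \<partial> b f x - \<partial> b (\<partial> b f) x)"
    by (simp add: number_operator_def laplacian_eq[OF B assms] sum_subtractf)
qed

lemma poly_fun_number_operator:
  fixes f :: "'a \<Rightarrow> real"
  assumes "poly_fun f"
  shows "poly_fun (number_operator f)"
  using assms finite_basis[OF B] by (simp add: number_operator_eq)

lemma number_operator_diff:
  fixes f g :: "'a \<Rightarrow> real"
  assumes "poly_fun f" "poly_fun g"
  shows "number_operator (\<lambda>x. f x - g x) = (\<lambda>x. number_operator f x - number_operator g x)"
  using assms by (simp add: number_operator_def fun_eq_iff laplacian_diff[OF B])

lemma number_operator_cmult:
  fixes f :: "'a \<Rightarrow> real"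
  assumes "poly_fun f"
  shows "number_operator (\<lambda>x. c * f x) = (\<lambda>x. c * number_operator f x)"
  using assms by (simp add: number_operator_def fun_eq_iff laplacian_cmult[OF B] algebra_simps)

lemma number_operator_const: "number_operator (\<lambda>x::'a. c) = (\<lambda>x. 0)"
  by (simp add: number_operator_def fun_eq_iff laplacian_const[OF B])

text \<open>
  By Euler's identity the homogeneous part of degree \<open>n + 1\<close> cancels. In terms of derivatives,
  \<open>\<partial> u\<close> lowers the eigenvalue of the Euler field by one (\<open>partial_derivative_euler\<close>), which
  gives an induction on \<open>n\<close> that never mentions homogeneous parts.
\<close>

lemma degree_le_euler:
  fixes f :: "'a \<Rightarrow> real"
  assumes "degree_le (Suc n) f"
  shows "degree_le n (\<lambda>x. \<partial> x f x - real (Suc n) * f x)"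
  using assms
proof (induction n arbitrary: f)
  case 0
  let ?g = "\<lambda>x. \<partial> x f x - f x"
  have f: "poly_fun f" "\<exists>c. \<partial> u f = (\<lambda>_. c)" for u
    using 0 by auto
  have g: "poly_fun ?g"
    using f(1) poly_fun_euler[OF B] by simp
  have "\<partial> u ?g = (\<lambda>x. 0)" for u
  proof -
    have "\<partial> u ?g = (\<lambda>x. \<partial> x (\<partial> u f) x)"
      using f(1) by (simp add: poly_fun_euler[OF B] partial_derivative_euler[OF B])
    moreover obtain c where "\<partial> u f = (\<lambda>_. c)"
      using f(2) by blast
    ultimately show ?thesis
      by simp
  qed
  from poly_fun_constant_if_derivatives_vanish[OF g this]
  have "degree_le 0 ?g"
    unfolding degree_le.simps by blast
  then show ?case
    by simp
next
  case (Suc n)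
  have f: "poly_fun f" "degree_le (Suc n) (\<partial> u f)" for u
    using Suc.prems by auto
  have "\<partial> u (\<lambda>x. \<partial> x f x - real (Suc (Suc n)) * f x)
      = (\<lambda>x. \<partial> x (\<partial> u f) x - real (Suc n) * \<partial> u f x)" for u
    using f(1)
    by (simp add: poly_fun_euler[OF B] partial_derivative_euler[OF B] fun_eq_iff algebra_simps)
  moreover have "poly_fun (\<lambda>x. \<partial> x f x - real (Suc (Suc n)) * f x)"
    using f(1) poly_fun_euler[OF B] by simp
  ultimately show ?case
    using Suc.IH[OF f(2)] by (subst degree_le.simps) (simp del: degree_le.simps of_nat_Suc)
qed

lemma degree_le_number_operator:
  fixes f :: "'a \<Rightarrow> real"
  assumes "degree_le (Suc n) f"
  shows "degree_le n (\<lambda>x. number_operator f x - real (Suc n) * f x)"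
  using degree_le_diff[OF degree_le_euler[OF assms] degree_le_laplacian[OF B assms]]
  by (simp add: number_operator_def algebra_simps)

end

section \<open>The Gaussian functional\<close>

text \<open>
  The series is \<open>(exp (\<Delta> / 2) f) 0\<close>, which for a polynomial is a finite sum and equals the expectation
  of \<open>f\<close> under the standard Gaussian measure.
\<close>

definition gauss :: "('a::real_inner \<Rightarrow> real) \<Rightarrow> real" where
  "gauss f = (\<Sum>m. (laplacian ^^ m) f 0 / (2 ^ m * fact m))"

context
  fixes B :: "'a::real_inner set"
  assumes B: "orthonormal_basis B"
begin

lemma laplacian_power_zero: "(laplacian ^^ m) (\<lambda>x::'a. 0) = (\<lambda>x. 0)"
  by (induction m) (simp_all add: laplacian_const[OF B])

lemma laplacian_power_degree:
  fixes f :: "'a \<Rightarrow> real"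
  assumes "degree_le d f" "d < m"
  shows "(laplacian ^^ m) f = (\<lambda>x. 0)"
  using assms
proof (induction d arbitrary: f m)
  case 0
  then obtain c k where "f = (\<lambda>_. c)" "m = Suc k"
    by (cases m) auto
  then show ?case
    by (simp add: funpow_Suc_right laplacian_const[OF B] laplacian_power_zero del: funpow.simps)
next
  case (Suc d)
  then obtain k where "m = Suc k" "d < k"
    by (cases m) auto
  then show ?case
    using Suc.IH[OF degree_le_laplacian[OF B Suc.prems(1)]]
    by (simp add: funpow_Suc_right del: funpow.simps)
qed

lemma poly_fun_laplacian_power:
  fixes f :: "'a \<Rightarrow> real"
  assumes "poly_fun f"
  shows "poly_fun ((laplacian ^^ m) f)"
  using assms by (induction m) (simp_all add: poly_fun_laplacian[OF B])

lemma laplacian_power_add: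
  fixes f g :: "'a \<Rightarrow> real"
  assumes "poly_fun f" "poly_fun g"
  shows "(laplacian ^^ m) (\<lambda>x. f x + g x) = (\<lambda>x. (laplacian ^^ m) f x + (laplacian ^^ m) g x)"
  using assms
  by (induction m) (simp_all add: laplacian_add[OF B] poly_fun_laplacian_power)

lemma laplacian_power_cmult:
  fixes f :: "'a \<Rightarrow> real"
  assumes "poly_fun f"
  shows "(laplacian ^^ m) (\<lambda>x. c * f x) = (\<lambda>x. c * (laplacian ^^ m) f x)"
  using assms
  by (induction m) (simp_all add: laplacian_cmult[OF B] poly_fun_laplacian_power)

lemma summable_gauss:
  fixes f :: "'a \<Rightarrow> real"
  assumes "poly_fun f"
  shows "summable (\<lambda>m. (laplacian ^^ m) f 0 / (2 ^ m * fact m))"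
proof -
  obtain d where "degree_le d f"
    using poly_fun_has_degree[OF assms] ..
  then have "(laplacian ^^ m) f = (\<lambda>x. 0)" if "m \<notin> {..d}" for m
    using that laplacian_power_degree by auto
  then show ?thesis
    by (intro summable_finite[of "{..d}"]) auto
qed

lemma gauss_add:
  fixes f g :: "'a \<Rightarrow> real"
  assumes "poly_fun f" "poly_fun g"
  shows "gauss (\<lambda>x. f x + g x) = gauss f + gauss g"
  using assms
  by (simp add: gauss_def laplacian_power_add add_divide_distrib suminf_add summable_gauss)

lemma gauss_cmult:
  fixes f :: "'a \<Rightarrow> real"
  assumes "poly_fun f"
  shows "gauss (\<lambda>x. c * f x) = c * gauss f"
  using suminf_mult[OF summable_gauss[OF assms], of c] assms
  by (simp add: gauss_def laplacian_power_cmult)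

lemma gauss_const: "gauss (\<lambda>x::'a. c) = c"
proof -
  have "(laplacian ^^ m) (\<lambda>x::'a. c) = (\<lambda>x. 0)" if "m \<noteq> 0" for m
    using that laplacian_power_degree[OF degree_le_const[of 0 c]] by simp
  then have "gauss (\<lambda>x::'a. c) = (\<Sum>m\<in>{0}. (laplacian ^^ m) (\<lambda>x::'a. c) 0 / (2 ^ m * fact m))"
    unfolding gauss_def by (intro suminf_finite) auto
  then show ?thesis
    by simp
qed

lemma gauss_diff:
  fixes f g :: "'a \<Rightarrow> real"
  assumes "poly_fun f" "poly_fun g"
  shows "gauss (\<lambda>x. f x - g x) = gauss f - gauss g"
  using gauss_add[OF assms(1), of "\<lambda>x. (- 1) * g x"] gauss_cmult[OF assms(2), of "- 1"] assms(2)
  by simp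

lemma gauss_sum:
  fixes f :: "'i \<Rightarrow> 'a \<Rightarrow> real"
  assumes "finite I" "\<And>i. i \<in> I \<Longrightarrow> poly_fun (f i)"
  shows "gauss (\<lambda>x. \<Sum>i\<in>I. f i x) = (\<Sum>i\<in>I. gauss (f i))"
  using assms by (induction I rule: finite_induct) (simp_all add: gauss_add gauss_const)

lemma partial_derivative_laplacian_power:
  fixes f :: "'a \<Rightarrow> real"
  assumes "poly_fun f"
  shows "\<partial> u ((laplacian ^^ m) f) = (laplacian ^^ m) (\<partial> u f)"
  using assms
  by (induction m) (simp_all add: partial_derivative_laplacian[OF B] poly_fun_laplacian_power)

lemma laplacian_power_inner_mult:
  fixes f :: "'a \<Rightarrow> real"
  assumes "poly_fun f"
  shows "(laplacian ^^ Suc m) (\<lambda>x. (x \<bullet> u) * f x) =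
    (\<lambda>x. (x \<bullet> u) * (laplacian ^^ Suc m) f x + 2 * real (Suc m) * (laplacian ^^ m) (\<partial> u f) x)"
proof (induction m)
  case 0
  then show ?case
    by (simp add: laplacian_inner_mult[OF B assms])
next
  case (Suc m)
  let ?g = "(laplacian ^^ Suc m) f" and ?h = "(laplacian ^^ m) (\<partial> u f)"
  have g: "poly_fun ?g" and h: "poly_fun ?h"
    using assms by (intro poly_fun_laplacian_power; simp)+
  have "(laplacian ^^ Suc (Suc m)) (\<lambda>x. (x \<bullet> u) * f x)
      = laplacian (\<lambda>x. (x \<bullet> u) * ?g x + 2 * real (Suc m) * ?h x)"
    using Suc.IH by simp
  also have "\<dots> = (\<lambda>x. ((x \<bullet> u) * laplacian ?g x + 2 * \<partial> u ?g x) + 2 * real (Suc m) * laplacian ?h x)"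
    using g h
    by (subst laplacian_add[OF B]) (simp_all only: laplacian_inner_mult[OF B] laplacian_cmult[OF B],
        simp_all)
  also have "\<partial> u ?g = laplacian ?h"
    using partial_derivative_laplacian_power[OF assms, of u "Suc m"] by simp
  finally show ?case
    by (simp add: algebra_simps)
qed

text \<open>
  This is Gaussian integration by parts. Each power of the Laplacian contributes the commutator
  \<open>[\<Delta>\<^sup>m, x \<bullet> u] = 2 m \<Delta>\<^sup>m\<^sup>-\<^sup>1 \<partial> u\<close>, whose factor \<open>2 m\<close> shifts the weights \<open>1 / (2\<^sup>m m!)\<close>
  by one index, while the remaining term vanishes at the origin.
\<close>

lemma gauss_inner_mult:
  fixes f :: "'a \<Rightarrow> real"
  assumes "poly_fun f"
  shows "gauss (\<lambda>x. (x \<bullet> u) * f x) = gauss (\<partial> u f)"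
proof -
  let ?a = "\<lambda>m. (laplacian ^^ m) (\<lambda>x. (x \<bullet> u) * f x) 0 / (2 ^ m * fact m)"
  have "?a (Suc m) = (laplacian ^^ m) (\<partial> u f) 0 / (2 ^ m * fact m)" for m
  proof -
    have "(laplacian ^^ Suc m) (\<lambda>x. (x \<bullet> u) * f x) 0
        = 2 * real (Suc m) * (laplacian ^^ m) (\<partial> u f) 0"
      by (simp add: laplacian_power_inner_mult[OF assms] del: funpow.simps)
    moreover have "(2::real) ^ Suc m * fact (Suc m) = 2 * real (Suc m) * (2 ^ m * fact m)"
      by simp
    ultimately show ?thesis
      by (simp only: mult_divide_mult_cancel_left_if) simp
  qed
  moreover have "?a 0 = 0"
    by simp
  moreover have "summable ?a"
    using assms by (intro summable_gauss) simp
  ultimately show ?thesis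
    unfolding gauss_def using suminf_split_head[of ?a] by simp
qed

text \<open>
  The number operator is the adjoint of the gradient composed with the gradient, by integration
  by parts. Both its symmetry and the positivity of the inner product come from this formula.
\<close>

lemma gauss_mult_number_operator:
  fixes f g :: "'a \<Rightarrow> real"
  assumes "poly_fun f" "poly_fun g"
  shows "gauss (\<lambda>x. f x * number_operator g x) = (\<Sum>b\<in>B. gauss (\<lambda>x. \<partial> b f x * \<partial> b g x))"
proof -
  have "gauss (\<lambda>x. f x * number_operator g x)
      = gauss (\<lambda>x. \<Sum>b\<in>B. (x \<bullet> b) * (f x * \<partial> b g x) - f x * \<partial> b (\<partial> b g) x)"
    by (simp add: number_operator_eq[OF B assms(2)] sum_distrib_left algebra_simps)
  also have "\<dots> = (\<Sum>b\<in>B. gauss (\<lambda>x. (x \<bullet> b) * (f x * \<partial> b g x))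
                         - gauss (\<lambda>x. f x * \<partial> b (\<partial> b g) x))"
    using assms finite_basis[OF B] by (simp add: gauss_sum gauss_diff)
  also have "\<dots> = (\<Sum>b\<in>B. gauss (\<lambda>x. \<partial> b f x * \<partial> b g x))"
    using assms by (simp add: gauss_inner_mult gauss_add)
  finally show ?thesis .
qed

lemma number_operator_symmetric:
  fixes f g :: "'a \<Rightarrow> real"
  assumes "poly_fun f" "poly_fun g"
  shows "gauss (\<lambda>x. f x * number_operator g x) = gauss (\<lambda>x. number_operator f x * g x)"
  using gauss_mult_number_operator[OF assms] gauss_mult_number_operator[OF assms(2,1)]
  by (simp add: mult.commute)

end

section \<open>Laplacian subalgebras\<close>

lemma laplacian_subalgebraD:
  assumes "laplacian_subalgebra T"
  shows "f \<in> T \<Longrightarrow> poly_fun f"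
    and "(\<lambda>x. c) \<in> T"
    and "f \<in> T \<Longrightarrow> g \<in> T \<Longrightarrow> (\<lambda>x. f x + g x) \<in> T"
    and "f \<in> T \<Longrightarrow> g \<in> T \<Longrightarrow> (\<lambda>x. f x * g x) \<in> T"
    and "f \<in> T \<Longrightarrow> laplacian f \<in> T"
    and "(\<lambda>x. (norm x)\<^sup>2) \<in> T"
  using assms by (auto simp: laplacian_subalgebra_def polynomial_subalgebra_def)

lemma laplacian_subalgebra_cmult:
  assumes "laplacian_subalgebra T" "f \<in> T"
  shows "(\<lambda>x. c * f x) \<in> T"
  using laplacian_subalgebraD(4)[OF assms(1) laplacian_subalgebraD(2)[OF assms(1)] assms(2)] .

lemma laplacian_subalgebra_diff:
  assumes "laplacian_subalgebra T" "f \<in> T" "g \<in> T"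
  shows "(\<lambda>x. f x - g x) \<in> T"
  using laplacian_subalgebraD(3)[OF assms(1,2) laplacian_subalgebra_cmult[OF assms(1,3), of "-1"]]
  by simp

lemma partial_derivative_inner_linear:
  assumes "linear L" "linear M"
  shows "\<partial> u (\<lambda>x. L x \<bullet> M x) = (\<lambda>x. L u \<bullet> M x + L x \<bullet> M u)"
proof (intro ext partial_derivative_eqI)
  fix x
  have "L (x + t *\<^sub>R u) \<bullet> M (x + t *\<^sub>R u)
      = L x \<bullet> M x + t * (L u \<bullet> M x + L x \<bullet> M u) + t\<^sup>2 * (L u \<bullet> M u)" for t
    by (simp add: linear_add[OF assms(1)] linear_add[OF assms(2)] linear_scale[OF assms(1)]
        linear_scale[OF assms(2)] algebra_simps power2_eq_square)
  moreover have "((\<lambda>t. L x \<bullet> M x + t * (L u \<bullet> M x + L x \<bullet> M u) + t\<^sup>2 * (L u \<bullet> M u))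
      has_real_derivative (L u \<bullet> M x + L x \<bullet> M u)) (at 0)"
    by (auto intro!: derivative_eq_intros)
  ultimately show "((\<lambda>t. L (x + t *\<^sub>R u) \<bullet> M (x + t *\<^sub>R u))
      has_real_derivative (L u \<bullet> M x + L x \<bullet> M u)) (at 0)"
    by simp
qed

context
  fixes B :: "'a::real_inner set" and T :: "('a \<Rightarrow> real) set"
  assumes B: "orthonormal_basis B" and T: "laplacian_subalgebra T"
begin

text \<open>
  Polarization of the Laplacian: the pairing is half the failure of \<open>\<Delta>\<close> to be a derivation.
\<close>

lemma gradient_pairing_closed:
  assumes "f \<in> T" "g \<in> T"
  shows "(\<lambda>x. \<Sum>b\<in>B. \<partial> b f x * \<partial> b g x) \<in> T"
proof -
  note T_intros = laplacian_subalgebraD[OF T] laplacian_subalgebra_diff[OF T]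
  have "(\<lambda>x. (1/2) * (laplacian (\<lambda>x. f x * g x) x - f x * laplacian g x - g x * laplacian f x)) \<in> T"
    using assms by (intro laplacian_subalgebra_cmult[OF T] T_intros)
  moreover have "(1/2) * (laplacian (\<lambda>x. f x * g x) x - f x * laplacian g x - g x * laplacian f x)
      = (\<Sum>b\<in>B. \<partial> b f x * \<partial> b g x)" for x
    using assms by (simp add: laplacian_mult[OF B] T_intros(1))
  ultimately show ?thesis
    by simp
qed

lemma partial_derivative_norm_square: "\<partial> u (\<lambda>x::'a. (norm x)\<^sup>2) = (\<lambda>x. 2 * (x \<bullet> u))"
  using partial_derivative_inner_linear[of "\<lambda>x::'a. x" "\<lambda>x. x" u]
  by (simp add: power2_norm_eq_inner inner_commute linear_id[unfolded id_def])

text \<open>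
  The Euler field is half the gradient pairing with \<open>r\<^sup>2\<close>.
\<close>

lemma number_operator_closed:
  assumes "f \<in> T"
  shows "number_operator f \<in> T"
proof -
  note f = laplacian_subalgebraD(1)[OF T assms]
  have "(\<Sum>b\<in>B. \<partial> b f x * \<partial> b (\<lambda>x. (norm x)\<^sup>2) x) = 2 * \<partial> x f x" for x
    using fun_cong[OF euler_eq[OF B f], of x]
    by (simp add: partial_derivative_norm_square sum_distrib_left algebra_simps)
  then have "(\<lambda>x. 2 * \<partial> x f x) \<in> T"
    using gradient_pairing_closed[OF assms laplacian_subalgebraD(6)[OF T]] by simp
  from laplacian_subalgebra_cmult[OF T this, of "1/2"] have "(\<lambda>x. \<partial> x f x) \<in> T"
    by simp
  then have "(\<lambda>x. \<partial> x f x - laplacian f x) \<in> T"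
    by (intro laplacian_subalgebra_diff[OF T] laplacian_subalgebraD[OF T] assms)
  then show ?thesis
    by (simp add: number_operator_def[abs_def])
qed

text \<open>
  On polynomials of degree at most \<open>n\<close> the number operator is triangular with eigenvalues
  \<open>0, \<dots>, n\<close>, so \<open>N - c\<close> can be inverted there by back substitution from the top degree down. Each
  substitution uses only the operations of \<open>T\<close>, so the solution stays in \<open>T\<close>.
\<close>

lemma number_operator_resolvent:
  assumes "degree_le n r" "r \<in> T" "real n < c"
  shows "\<exists>g\<in>T. degree_le n g \<and> (\<lambda>x. number_operator g x - c * g x) = r"
  using assms
proof (induction n arbitrary: r)
  case 0
  then obtain a where r: "r = (\<lambda>_. a)"
    by auto
  have "(\<lambda>_. - a / c) \<in> T"
    by (rule laplacian_subalgebraD[OF T])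
  moreover have "number_operator (\<lambda>_::'a. - a / c) = (\<lambda>_. 0)"
    by (rule number_operator_const[OF B])
  ultimately show ?case
    using 0 r by (intro bexI[of _ "\<lambda>_. - a / c"]) auto
next
  case (Suc n)
  \<comment> \<open>On the top-degree part \<open>N - c\<close> is multiplication by \<open>n + 1 - c\<close>, hence the leading guess \<open>k r\<close>;
    the error \<open>?r\<close> has lower degree.\<close>
  define k where "k = 1 / (real (Suc n) - c)"
  have k: "k * (real (Suc n) - c) = 1"
    using Suc.prems(3) by (simp add: k_def)
  let ?r = "\<lambda>x. k * (number_operator r x - real (Suc n) * r x)"
  have "degree_le n ?r"
    by (intro degree_le_cmult degree_le_number_operator[OF B] Suc.prems)
  moreover have "?r \<in> T"
    by (intro laplacian_subalgebra_cmult[OF T] laplacian_subalgebra_diff[OF T]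
        number_operator_closed Suc.prems)
  ultimately obtain g where g: "g \<in> T" "degree_le n g"
    "(\<lambda>x. number_operator g x - c * g x) = ?r"
    using Suc.IH[of ?r] Suc.prems(3) by auto
  let ?h = "\<lambda>x. k * r x - g x"
  have "?h \<in> T"
    by (intro laplacian_subalgebra_cmult[OF T] laplacian_subalgebra_diff[OF T] Suc.prems g)
  moreover have "degree_le (Suc n) ?h"
    by (intro degree_le_diff degree_le_cmult degree_le_Suc[OF g(2)] Suc.prems)
  moreover have "(\<lambda>x. number_operator ?h x - c * ?h x) = r"
  proof
    fix x
    have "number_operator ?h x - c * ?h x
        = k * number_operator r x - c * k * r x - (number_operator g x - c * g x)"
      using laplacian_subalgebraD(1)[OF T] Suc.prems(2) g(1)
      by (simp add: number_operator_diff[OF B] number_operator_cmult[OF B] algebra_simps)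
    also have "\<dots> = (k * (real (Suc n) - c)) * r x"
      by (simp only: fun_cong[OF g(3)]) (simp add: algebra_simps)
    finally show "number_operator ?h x - c * ?h x = r x"
      using k by simp
  qed
  ultimately show ?case
    by blast
qed

text \<open>
  This is the Hermite decomposition carried out inside \<open>T\<close>: the correction \<open>g\<close> of lower degree solves
  \<open>(N - (n + 1)) g = (N - (n + 1)) f\<close>, where the right-hand side has degree at most \<open>n\<close>.
\<close>

lemma split_top_eigenfunction:
  assumes "degree_le (Suc n) f" "f \<in> T"
  obtains g where "g \<in> T" "degree_le n g"
    "number_operator (\<lambda>x. f x - g x) = (\<lambda>x. real (Suc n) * (f x - g x))"
proof -
  obtain g where g: "g \<in> T" "degree_le n g"
    "(\<lambda>x. number_operator g x - real (Suc n) * g x)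
      = (\<lambda>x. number_operator f x - real (Suc n) * f x)"
    using number_operator_resolvent[OF degree_le_number_operator[OF B assms(1)], of "real (Suc n)"]
      laplacian_subalgebra_diff[OF T number_operator_closed laplacian_subalgebra_cmult[OF T]] assms(2)
    by auto
  have "number_operator (\<lambda>x. f x - g x) = (\<lambda>x. real (Suc n) * (f x - g x))"
  proof
    fix x
    show "number_operator (\<lambda>x. f x - g x) x = real (Suc n) * (f x - g x)"
      using fun_cong[OF g(3), of x] laplacian_subalgebraD(1)[OF T] assms(2) g(1)
      by (simp add: number_operator_diff[OF B] algebra_simps)
  qed
  with g(1,2) show thesis
    by (rule that)
qed

end

section \<open>The Gaussian inner product\<close>

definition gauss_inner :: "('a::real_inner \<Rightarrow> real) \<Rightarrow> ('a \<Rightarrow> real) \<Rightarrow> real" where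
  "gauss_inner f g = gauss (\<lambda>x. f x * g x)"

lemma gauss_inner_commute: "gauss_inner f g = gauss_inner g f"
  by (simp add: gauss_inner_def mult.commute)

context
  fixes B :: "'a::real_inner set"
  assumes B: "orthonormal_basis B"
begin

lemma gauss_inner_zero_right: "gauss_inner (f :: 'a \<Rightarrow> real) (\<lambda>x. 0) = 0"
  by (simp add: gauss_inner_def gauss_const[OF B])

lemma gauss_inner_add_right:
  fixes f g h :: "'a \<Rightarrow> real"
  assumes "poly_fun f" "poly_fun g" "poly_fun h"
  shows "gauss_inner f (\<lambda>x. g x + h x) = gauss_inner f g + gauss_inner f h"
  using assms by (simp add: gauss_inner_def distrib_left gauss_add[OF B])

lemma gauss_inner_diff_right:
  fixes f g h :: "'a \<Rightarrow> real"
  assumes "poly_fun f" "poly_fun g" "poly_fun h"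
  shows "gauss_inner f (\<lambda>x. g x - h x) = gauss_inner f g - gauss_inner f h"
  using assms by (simp add: gauss_inner_def right_diff_distrib gauss_diff[OF B])

lemma gauss_inner_cmult_right:
  fixes f g :: "'a \<Rightarrow> real"
  assumes "poly_fun f" "poly_fun g"
  shows "gauss_inner f (\<lambda>x. c * g x) = c * gauss_inner f g"
  using gauss_cmult[OF B, of "\<lambda>x. f x * g x" c] assms
  by (simp add: gauss_inner_def algebra_simps)

lemma gauss_inner_number_operator:
  fixes f g :: "'a \<Rightarrow> real"
  assumes "poly_fun f" "poly_fun g"
  shows "gauss_inner f (number_operator g) = gauss_inner (number_operator f) g"
  using number_operator_symmetric[OF B assms] by (simp add: gauss_inner_def)

text \<open>
  Symmetry of \<open>N\<close> makes eigenfunctions for different eigenvalues orthogonal. Since \<open>N - d\<close> lowers the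
  degree of a polynomial of degree \<open>d\<close>, the argument runs by induction without diagonalizing \<open>N\<close>.
\<close>

lemma eigenfunction_orthogonal_lower_degree:
  fixes u f :: "'a \<Rightarrow> real"
  assumes "poly_fun u" "number_operator u = (\<lambda>x. c * u x)" "degree_le d f" "real d < c"
  shows "gauss_inner u f = 0"
  using assms(3,4)
proof (induction d arbitrary: f)
  have eig: "gauss_inner u (number_operator f) = c * gauss_inner u f" if "poly_fun f" for f
    using that assms(1) gauss_inner_number_operator[OF assms(1) that]
    by (simp add: assms(2) gauss_inner_commute[of _ f] gauss_inner_cmult_right)
  {
    case 0
    then obtain a where "f = (\<lambda>_. a)"
      by auto
    then show ?case
      using eig[of f] 0 by (simp add: number_operator_const[OF B] gauss_inner_zero_right)
  next
    case (Suc d)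
    have f: "poly_fun f"
      using Suc.prems(1) by simp
    have "gauss_inner u (\<lambda>x. number_operator f x - real (Suc d) * f x) = 0"
      using Suc.prems by (intro Suc.IH degree_le_number_operator[OF B]) auto
    then have "(c - real (Suc d)) * gauss_inner u f = 0"
      using f assms(1)
      by (simp add: gauss_inner_diff_right gauss_inner_cmult_right eig
          poly_fun_number_operator[OF B] left_diff_distrib del: of_nat_Suc)
    then show ?case
      using Suc.prems(2) by simp
  }
qed

lemma laplacian_subalgebra_poly_fun: "laplacian_subalgebra (Collect poly_fun :: ('a \<Rightarrow> real) set)"
proof -
  have "(norm x)\<^sup>2 = (\<Sum>b\<in>B. (b \<bullet> x) * (b \<bullet> x))" for x :: 'a
    using parseval[OF B, of x x] by (simp add: power2_norm_eq_inner)
  then show ?thesis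
    using finite_basis[OF B]
    by (auto simp: laplacian_subalgebra_def polynomial_subalgebra_def poly_fun_laplacian[OF B])
qed

text \<open>
  A polynomial of degree at most \<open>n + 1\<close> is \<open>u + g\<close> with \<open>N u = (n + 1) u\<close> and \<open>g\<close> of lower degree and
  orthogonal to \<open>u\<close>. The energy identity \<open>(n + 1) \<langle>u, u\<rangle> = \<Sum>\<^sub>b \<langle>\<partial> b u, \<partial> b u\<rangle>\<close> then reduces both summands to
  lower degree.
\<close>

lemma gauss_inner_positive_definite:
  fixes f :: "'a \<Rightarrow> real"
  assumes "degree_le d f"
  shows "gauss_inner f f \<ge> 0 \<and> (gauss_inner f f = 0 \<longrightarrow> f = (\<lambda>x. 0))"
  using assms
proof (induction d arbitrary: f)
  case 0
  then show ?case
    by (auto simp: gauss_inner_def gauss_const[OF B])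
next
  case (Suc n)
  obtain g where g: "poly_fun g" "degree_le n g"
    and eig: "number_operator (\<lambda>x. f x - g x) = (\<lambda>x. real (Suc n) * (f x - g x))"
    using split_top_eigenfunction[OF B laplacian_subalgebra_poly_fun Suc.prems]
      poly_fun_if_degree_le[OF Suc.prems] by auto
  define u where "u = (\<lambda>x. f x - g x)"
  have u: "poly_fun u" "degree_le (Suc n) u"
    unfolding u_def
    by (intro poly_fun_intros poly_fun_if_degree_le[OF Suc.prems] g)
      (intro degree_le_diff Suc.prems degree_le_Suc[OF g(2)])
  have N: "number_operator u = (\<lambda>x. real (Suc n) * u x)"
    using eig by (simp add: u_def)
  have du: "degree_le n (\<partial> b u)" for b
    using u(2) by simp
  have energy: "real (Suc n) * gauss_inner u u = (\<Sum>b\<in>B. gauss_inner (\<partial> b u) (\<partial> b u))"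
    using gauss_mult_number_operator[OF B u(1) u(1)] gauss_inner_cmult_right[OF u(1) u(1)]
    by (simp add: gauss_inner_def N del: of_nat_Suc)
  have nonneg: "gauss_inner (\<partial> b u) (\<partial> b u) \<ge> 0" for b
    using Suc.IH[OF du] by blast
  have "real (Suc n) * gauss_inner u u \<ge> 0"
    unfolding energy using nonneg by (intro sum_nonneg)
  then have u_nonneg: "gauss_inner u u \<ge> 0"
    by (simp add: zero_le_mult_iff del: of_nat_Suc)
  have u_zero: "u = (\<lambda>x. 0)" if "gauss_inner u u = 0"
  proof -
    have "gauss_inner (\<partial> b u) (\<partial> b u) = 0" if "b \<in> B" for b
      using energy \<open>gauss_inner u u = 0\<close> that nonneg finite_basis[OF B]
      by (simp add: sum_nonneg_eq_0_iff)
    then have "\<partial> b u = (\<lambda>x. 0)" if "b \<in> B" for b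
      using Suc.IH[OF du] that by blast
    then have "\<partial> v u x = 0" for v x
      using partial_derivative_expand[OF B u(1), of v x] by simp
    \<comment> \<open>A constant is killed by \<open>N\<close>, whereas the eigenvalue of \<open>u\<close> is positive.\<close>
    then have "u = (\<lambda>x. u 0)"
      using u(1) by (intro poly_fun_constant_if_derivatives_vanish) auto
    then have "number_operator u = (\<lambda>x. 0)"
      using number_operator_const[OF B] by metis
    then show ?thesis
      using N by (simp add: fun_eq_iff del: of_nat_Suc)
  qed
  have orth: "gauss_inner u g = 0"
    using eigenfunction_orthogonal_lower_degree[OF u(1) N g(2)] by simp
  have f: "f = (\<lambda>x. u x + g x)"
    by (simp add: u_def)
  have "gauss_inner f f = gauss_inner u u + gauss_inner g g"
  proof -
    have "gauss_inner f f = gauss_inner f u + gauss_inner f g"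
      by (subst (2) f) (intro gauss_inner_add_right poly_fun_if_degree_le[OF Suc.prems] u g)
    also have "gauss_inner f u = gauss_inner u u"
      using orth u g by (subst gauss_inner_commute, subst f) (simp add: gauss_inner_add_right)
    also have "gauss_inner f g = gauss_inner g g"
      using orth u g
      by (subst gauss_inner_commute, subst f) (simp add: gauss_inner_add_right gauss_inner_commute[of g u])
    finally show ?thesis .
  qed
  then show ?case
    using u_nonneg u_zero Suc.IH[OF g(2)] f by auto
qed

lemma gauss_inner_self_eq_0:
  fixes f :: "'a \<Rightarrow> real"
  assumes "poly_fun f" "gauss_inner f f = 0"
  shows "f = (\<lambda>x. 0)"
  using poly_fun_has_degree[OF assms(1)] gauss_inner_positive_definite assms(2) by blast

end

section \<open>Orthogonal projection onto a Laplacian subalgebra\<close>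

text \<open>
  The functionals of interest evaluate derivatives. They are linear on polynomials but not on all
  functions, because the derivative of a non-differentiable function is an arbitrary value.
\<close>

definition linear_on_poly_fun :: "(('a::real_inner \<Rightarrow> real) \<Rightarrow> real) \<Rightarrow> bool" where
  "linear_on_poly_fun \<phi> \<longleftrightarrow>
     (\<forall>f g. poly_fun f \<longrightarrow> poly_fun g \<longrightarrow> \<phi> (\<lambda>x. f x + g x) = \<phi> f + \<phi> g) \<and>
     (\<forall>c f. poly_fun f \<longrightarrow> \<phi> (\<lambda>x. c * f x) = c * \<phi> f)"

context
  fixes B :: "'a::real_inner set"
  assumes B: "orthonormal_basis B"
begin

text \<open>
  Polynomials of bounded degree form a finite-dimensional space. The form used here is that finitely
  many linear functionals, the iterated partial derivatives at the origin, separate its elements.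
\<close>

lemma degree_le_finitely_many_coordinates:
  "\<exists>\<Phi>. finite \<Phi> \<and> (\<forall>\<phi>\<in>\<Phi>. linear_on_poly_fun \<phi>) \<and>
     (\<forall>f::'a \<Rightarrow> real. degree_le d f \<longrightarrow> (\<forall>\<phi>\<in>\<Phi>. \<phi> f = 0) \<longrightarrow> f = (\<lambda>x. 0))"
proof (induction d)
  case 0
  show ?case
    by (intro exI[of _ "{\<lambda>f. f 0}"]) (auto simp: linear_on_poly_fun_def)
next
  case (Suc d)
  then obtain \<Phi> where fin: "finite \<Phi>" and lin: "\<forall>\<phi>\<in>\<Phi>. linear_on_poly_fun \<phi>"
    and sep: "\<forall>f::'a \<Rightarrow> real. degree_le d f \<longrightarrow> (\<forall>\<phi>\<in>\<Phi>. \<phi> f = 0) \<longrightarrow> f = (\<lambda>x. 0)"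
    by (elim exE conjE) (rule that)
  define \<Psi> where "\<Psi> = insert (\<lambda>f. f 0) ((\<lambda>(\<phi>, b) f. \<phi> (\<partial> b f)) ` (\<Phi> \<times> B))"
  have "finite \<Psi>"
    using fin finite_basis[OF B] by (simp add: \<Psi>_def)
  moreover have "linear_on_poly_fun (\<lambda>f. \<phi> (\<partial> b f))" if "\<phi> \<in> \<Phi>" for \<phi> b
    using bspec[OF lin that] by (simp add: linear_on_poly_fun_def)
  then have "linear_on_poly_fun \<psi>" if "\<psi> \<in> \<Psi>" for \<psi>
    using that by (auto simp: \<Psi>_def linear_on_poly_fun_def[of "\<lambda>f. f 0"])
  moreover have "f = (\<lambda>x. 0)" if f: "degree_le (Suc d) f" "\<And>\<psi>. \<psi> \<in> \<Psi> \<Longrightarrow> \<psi> f = 0" for f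
  proof -
    have "\<partial> b f = (\<lambda>x. 0)" if "b \<in> B" for b
    proof -
      have "degree_le d (\<partial> b f)"
        using f(1) by simp
      moreover have "\<forall>\<phi>\<in>\<Phi>. \<phi> (\<partial> b f) = 0"
        using f(2)[of "\<lambda>f. \<phi> (\<partial> b f)" for \<phi>] that by (force simp: \<Psi>_def)
      ultimately show ?thesis
        using sep by (elim allE[of _ "\<partial> b f"] impE)
    qed
    then have "\<partial> v f x = 0" for v x
      using partial_derivative_expand[OF B poly_fun_if_degree_le[OF f(1)], of v x] by simp
    then have "f = (\<lambda>x. f 0)"
      by (intro poly_fun_constant_if_derivatives_vanish poly_fun_if_degree_le[OF f(1)]) auto
    moreover have "f 0 = 0"
      using f(2)[of "\<lambda>f. f 0"] by (simp add: \<Psi>_def)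
    ultimately show ?thesis
      by simp
  qed
  ultimately show ?case
    by (intro exI[of _ \<Psi>] conjI ballI allI impI) (simp_all only: ball_simps)
qed

text \<open>
  Finite dimension of \<open>S\<close> enters through the separating functionals \<open>\<Phi>\<close>. Removing one functional \<open>\<phi>\<close>
  replaces \<open>S\<close> by the kernel of \<open>\<phi>\<close>, of codimension at most one, and a Gram-Schmidt step supplies the
  missing direction.
\<close>

lemma orthogonal_projection:
  fixes S :: "('a \<Rightarrow> real) set"
  assumes "finite \<Phi>" "\<And>\<phi>. \<phi> \<in> \<Phi> \<Longrightarrow> linear_on_poly_fun \<phi>"
    and "\<And>f. f \<in> S \<Longrightarrow> poly_fun f"
    and "(\<lambda>x. 0) \<in> S"
    and "\<And>f g. f \<in> S \<Longrightarrow> g \<in> S \<Longrightarrow> (\<lambda>x. f x + g x) \<in> S"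
    and "\<And>c f. f \<in> S \<Longrightarrow> (\<lambda>x. c * f x) \<in> S"
    and "\<And>f. f \<in> S \<Longrightarrow> (\<And>\<phi>. \<phi> \<in> \<Phi> \<Longrightarrow> \<phi> f = 0) \<Longrightarrow> f = (\<lambda>x. 0)"
    and "poly_fun h"
  shows "\<exists>s\<in>S. \<forall>f\<in>S. gauss_inner f (\<lambda>x. h x - s x) = 0"
  using assms
proof (induction \<Phi> arbitrary: S h rule: finite_induct)
  case empty
  have "gauss_inner f (\<lambda>x. h x - 0) = 0" if "f \<in> S" for f
  proof -
    have "f = (\<lambda>x. 0)"
      by (rule empty.prems(6)[OF that]) simp
    then show ?thesis
      using gauss_inner_zero_right[OF B, of h] by (simp add: gauss_inner_commute[of _ h])
  qed
  with empty.prems(3) show ?case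
    by (intro bexI[of _ "\<lambda>x. 0"] ballI)
next
  case (insert \<phi> \<Phi>)
  have lin: "\<phi> (\<lambda>x. f x + g x) = \<phi> f + \<phi> g" "\<phi> (\<lambda>x. c * f x) = c * \<phi> f"
    if "poly_fun f" "poly_fun g" for f g c
    using insert.prems(1)[of \<phi>] that by (auto simp: linear_on_poly_fun_def)
  define S' where "S' = {f \<in> S. \<phi> f = 0}"
  have proj: "\<exists>s\<in>S'. \<forall>f\<in>S'. gauss_inner f (\<lambda>x. h x - s x) = 0" if "poly_fun h" for h
  proof (rule insert.IH)
    show "linear_on_poly_fun \<psi>" if "\<psi> \<in> \<Phi>" for \<psi>
      using insert.prems(1) that by blast
    show "poly_fun f" if "f \<in> S'" for f
      using insert.prems(2) that by (simp add: S'_def)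
    show "(\<lambda>x. 0) \<in> S'"
      using insert.prems(3) lin(2)[of "\<lambda>x. 0" "\<lambda>x. 0" 0] by (simp add: S'_def)
    show "(\<lambda>x. f x + g x) \<in> S'" if "f \<in> S'" "g \<in> S'" for f g
      using that insert.prems(4)[of f g] lin(1)[of f g] insert.prems(2) by (simp add: S'_def)
    show "(\<lambda>x. c * f x) \<in> S'" if "f \<in> S'" for c f
      using that insert.prems(5)[of f c] lin(2)[of f f c] insert.prems(2) by (simp add: S'_def)
    show "f = (\<lambda>x. 0)" if "f \<in> S'" "\<And>\<psi>. \<psi> \<in> \<Phi> \<Longrightarrow> \<psi> f = 0" for f
    proof (rule insert.prems(6))
      show "f \<in> S"
        using that(1) by (simp add: S'_def)
      show "\<psi> f = 0" if "\<psi> \<in> insert \<phi> \<Phi>" for \<psi>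
        using that \<open>f \<in> S'\<close> \<open>\<And>\<psi>. \<psi> \<in> \<Phi> \<Longrightarrow> \<psi> f = 0\<close> by (auto simp: S'_def)
    qed
  qed (rule that)
  show ?case
  proof (cases "S' = S")
    case True
    then show ?thesis
      using proj insert.prems(7) by simp
  next
    case False
    then obtain s0 where s0: "s0 \<in> S" "\<phi> s0 \<noteq> 0"
      by (auto simp: S'_def)
    obtain p where p: "p \<in> S'" "\<And>f. f \<in> S' \<Longrightarrow> gauss_inner f (\<lambda>x. s0 x - p x) = 0"
      using proj[OF insert.prems(2)[OF s0(1)]] by blast
    have diff: "(\<lambda>x. f x - g x) \<in> S" if "f \<in> S" "g \<in> S" for f g
      using insert.prems(4)[OF that(1) insert.prems(5)[OF that(2), of "-1"]] by simp
    \<comment> \<open>\<open>e\<close> spans the orthogonal complement of \<open>S'\<close> in \<open>S\<close>.\<close>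
    define e where "e = (\<lambda>x. s0 x - p x)"
    have e: "e \<in> S"
      unfolding e_def using s0(1) p(1) by (intro diff) (auto simp: S'_def)
    have "\<phi> (\<lambda>x. e x + p x) = \<phi> e + \<phi> p"
      using p(1) by (intro lin(1) insert.prems(2) e) (simp add: S'_def)
    then have \<phi>e: "\<phi> e \<noteq> 0"
      using s0(2) p(1) by (simp add: e_def S'_def)
    have "\<phi> (\<lambda>x. 0) = 0"
      using lin(2)[of "\<lambda>x. 0" "\<lambda>x. 0" 0] by simp
    with \<phi>e have "e \<noteq> (\<lambda>x. 0)"
      by auto
    then have ee: "gauss_inner e e \<noteq> 0"
      using gauss_inner_self_eq_0[OF B insert.prems(2)[OF e]] by blast
    obtain q where q: "q \<in> S'" "\<And>f. f \<in> S' \<Longrightarrow> gauss_inner f (\<lambda>x. h x - q x) = 0"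
      using proj[OF insert.prems(7)] by blast
    have qS: "q \<in> S"
      using q(1) by (simp add: S'_def)
    define c where "c = gauss_inner e h / gauss_inner e e"
    define s where "s = (\<lambda>x. q x + c * e x)"
    have s: "s \<in> S"
      unfolding s_def by (intro insert.prems(4,5) e qS)
    note pf = insert.prems(2)[OF e] insert.prems(2)[OF qS] insert.prems(2)[OF s] insert.prems(7)
    have eS': "gauss_inner f e = 0" if "f \<in> S'" for f
      using p(2)[OF that] by (simp add: e_def)
    have hs: "gauss_inner f (\<lambda>x. h x - s x)
        = gauss_inner f (\<lambda>x. h x - q x) - c * gauss_inner f e" if "poly_fun f" for f
      using that pf
      by (simp add: s_def gauss_inner_diff_right[OF B] gauss_inner_add_right[OF B]
          gauss_inner_cmult_right[OF B])
    have "gauss_inner f (\<lambda>x. h x - s x) = 0" if f: "f \<in> S" for f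
    proof -
      define a where "a = \<phi> f / \<phi> e"
      define f' where "f' = (\<lambda>x. f x - a * e x)"
      have f'S: "f' \<in> S"
        unfolding f'_def by (intro diff f insert.prems(5) e)
      have "\<phi> (\<lambda>x. f' x + a * e x) = \<phi> f' + a * \<phi> e"
        using lin insert.prems(2)[OF f'S] pf(1) by simp
      then have f'S': "f' \<in> S'"
        using f'S \<phi>e by (simp add: S'_def f'_def a_def)
      have "gauss_inner f' (\<lambda>x. h x - s x) = 0"
        using hs[OF insert.prems(2)[OF f'S]] q(2)[OF f'S'] eS'[OF f'S'] by simp
      moreover have "gauss_inner e (\<lambda>x. h x - s x) = 0"
        using hs[OF pf(1)] pf eS'[OF q(1)] ee
        by (simp add: gauss_inner_diff_right[OF B] c_def gauss_inner_commute[of e q])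
      moreover have "gauss_inner f (\<lambda>x. h x - s x)
          = gauss_inner f' (\<lambda>x. h x - s x) + a * gauss_inner e (\<lambda>x. h x - s x)"
      proof -
        let ?m = "\<lambda>x. h x - s x"
        have "gauss_inner ?m f = gauss_inner ?m (\<lambda>x. f' x + a * e x)"
          by (simp add: f'_def)
        also have "\<dots> = gauss_inner ?m f' + a * gauss_inner ?m e"
          using pf insert.prems(2)[OF f'S]
          by (simp add: gauss_inner_add_right[OF B] gauss_inner_cmult_right[OF B])
        finally show ?thesis
          by (simp only: gauss_inner_commute[of ?m])
      qed
      ultimately show ?thesis
        by simp
    qed
    with s show ?thesis
      by (intro bexI[of _ s] ballI)
  qed
qed

text \<open>
  The projection \<open>s\<close> onto the elements of \<open>T\<close> of degree at most \<open>d = deg h\<close> works for all of \<open>T\<close>: an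
  element of \<open>T\<close> of degree above \<open>d\<close> differs from one of smaller degree by an eigenfunction of \<open>N\<close>, which
  is orthogonal to \<open>h - s\<close> because \<open>h - s\<close> has degree at most \<open>d\<close>.
\<close>

lemma projection_onto_laplacian_subalgebra:
  fixes T :: "('a \<Rightarrow> real) set"
  assumes T: "laplacian_subalgebra T" and h: "poly_fun h"
  shows "\<exists>s\<in>T. \<forall>f\<in>T. gauss_inner f (\<lambda>x. h x - s x) = 0"
proof -
  obtain d where d: "degree_le d h"
    using poly_fun_has_degree[OF h] ..
  obtain \<Phi> where \<Phi>: "finite \<Phi>" "\<forall>\<phi>\<in>\<Phi>. linear_on_poly_fun \<phi>"
    "\<forall>f::'a \<Rightarrow> real. degree_le d f \<longrightarrow> (\<forall>\<phi>\<in>\<Phi>. \<phi> f = 0) \<longrightarrow> f = (\<lambda>x. 0)"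
    using degree_le_finitely_many_coordinates[of d] by (elim exE conjE) (rule that)
  define S where "S = {f \<in> T. degree_le d f}"
  have "\<exists>s\<in>S. \<forall>f\<in>S. gauss_inner f (\<lambda>x. h x - s x) = 0"
  proof (rule orthogonal_projection[OF \<Phi>(1) _ _ _ _ _ _ h])
    show "linear_on_poly_fun \<phi>" if "\<phi> \<in> \<Phi>" for \<phi>
      using \<Phi>(2) that by (rule bspec)
    show "f = (\<lambda>x. 0)" if "f \<in> S" "\<And>\<phi>. \<phi> \<in> \<Phi> \<Longrightarrow> \<phi> f = 0" for f
    proof -
      have "degree_le d f" "\<forall>\<phi>\<in>\<Phi>. \<phi> f = 0"
        using that by (simp_all add: S_def)
      with \<Phi>(3) show ?thesis
        by (elim allE[of _ f] impE)
    qed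
    show "poly_fun f" if "f \<in> S" for f
      using that laplacian_subalgebraD(1)[OF T] by (simp add: S_def)
    show "(\<lambda>x. 0) \<in> S"
      using laplacian_subalgebraD(2)[OF T] by (simp add: S_def)
    show "(\<lambda>x. f x + g x) \<in> S" if "f \<in> S" "g \<in> S" for f g
      using that laplacian_subalgebraD(3)[OF T, of f g] degree_le_add[of d f g] by (simp add: S_def)
    show "(\<lambda>x. c * f x) \<in> S" if "f \<in> S" for c f
      using that laplacian_subalgebra_cmult[OF T, of f c] degree_le_cmult[of d f c] by (simp add: S_def)
  qed
  then obtain s where sS: "s \<in> S" and "\<forall>f\<in>S. gauss_inner f (\<lambda>x. h x - s x) = 0" ..
  then have orth: "gauss_inner f (\<lambda>x. h x - s x) = 0" if "f \<in> T" "degree_le d f" for f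
    using that by (simp add: S_def)
  have s: "s \<in> T" "degree_le d s"
    using sS by (simp_all add: S_def)
  let ?m = "\<lambda>x. h x - s x"
  have m: "degree_le d ?m"
    by (intro degree_le_diff d s)
  have "gauss_inner f ?m = 0" if "f \<in> T" "degree_le (d + k) f" for f k
    using that
  proof (induction k arbitrary: f)
    case 0
    then show ?case
      by (simp add: orth)
  next
    case (Suc k)
    obtain g where g: "g \<in> T" "degree_le (d + k) g"
      and eig: "number_operator (\<lambda>x. f x - g x) = (\<lambda>x. real (Suc (d + k)) * (f x - g x))"
      using split_top_eigenfunction[OF B T, of "d + k" f] Suc.prems by auto
    note pf = laplacian_subalgebraD(1)[OF T Suc.prems(1)] laplacian_subalgebraD(1)[OF T g(1)]
      poly_fun_if_degree_le[OF m]
    have "gauss_inner (\<lambda>x. f x - g x) ?m = 0"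
      using pf eig m by (intro eigenfunction_orthogonal_lower_degree[OF B _ eig m]) auto
    then have "gauss_inner ?m f = gauss_inner ?m g"
      using pf by (simp add: gauss_inner_commute[of _ ?m] gauss_inner_diff_right[OF B])
    then show ?case
      using Suc.IH[OF g] by (simp add: gauss_inner_commute[of _ ?m])
  qed
  then have "gauss_inner f ?m = 0" if f: "f \<in> T" for f
  proof -
    obtain e where "degree_le e f"
      using poly_fun_has_degree[OF laplacian_subalgebraD(1)[OF T f]] ..
    from degree_le_mono[OF le_add2 this] have "degree_le (d + e) f" .
    with f show ?thesis
      by (rule \<open>\<And>f k. f \<in> T \<Longrightarrow> degree_le (d + k) f \<Longrightarrow> gauss_inner f ?m = 0\<close>)
  qed
  with s(1) show ?thesis
    by (intro bexI[of _ s] ballI)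
qed

text \<open>
  Multiplication by \<open>b\<close> is symmetric and preserves \<open>T\<close>. So if \<open>m\<close> is the component of \<open>h\<close> orthogonal to
  \<open>T\<close>, then \<open>b m\<close> is orthogonal to \<open>T\<close>; but \<open>b m\<close> also lies in \<open>T\<close>, hence vanishes.
\<close>

theorem laplacian_subalgebra_contains_quotients:
  fixes T :: "('a \<Rightarrow> real) set"
  assumes T: "laplacian_subalgebra T" and "poly_fun h"
    and b: "b \<in> T" "b \<noteq> (\<lambda>x. 0)" and bh: "(\<lambda>x. b x * h x) \<in> T"
  shows "h \<in> T"
proof -
  obtain s where s: "s \<in> T" and orth: "\<forall>f\<in>T. gauss_inner f (\<lambda>x. h x - s x) = 0"
    using projection_onto_laplacian_subalgebra[OF T \<open>poly_fun h\<close>] ..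
  define m where "m = (\<lambda>x. h x - s x)"
  have m: "poly_fun m"
    unfolding m_def using \<open>poly_fun h\<close> laplacian_subalgebraD(1)[OF T s] by simp
  have "(\<lambda>x. b x * h x - b x * s x) \<in> T"
    by (rule laplacian_subalgebra_diff[OF T bh laplacian_subalgebraD(4)[OF T b(1) s]])
  then have bm: "(\<lambda>x. b x * m x) \<in> T"
    by (simp add: m_def right_diff_distrib)
  have "gauss_inner (\<lambda>x. b x * (b x * m x)) m = 0"
    using bspec[OF orth laplacian_subalgebraD(4)[OF T b(1) bm]] by (simp add: m_def)
  then have "gauss_inner (\<lambda>x. b x * m x) (\<lambda>x. b x * m x) = 0"
    by (simp add: gauss_inner_def algebra_simps)
  then have bm0: "(\<lambda>x. b x * m x) = (\<lambda>x. 0)"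
    using gauss_inner_self_eq_0[OF B laplacian_subalgebraD(1)[OF T bm]] by blast
  have "m = (\<lambda>x. 0)"
  proof (rule ccontr)
    assume "m \<noteq> (\<lambda>x. 0)"
    then obtain x y where "b x \<noteq> 0" "m y \<noteq> 0"
      using b(2) by (auto simp: fun_eq_iff)
    then obtain z where "b z * m z \<noteq> 0"
      using poly_fun_no_zero_divisors[OF laplacian_subalgebraD(1)[OF T b(1)] m] by blast
    then show False
      using bm0 by (auto simp: fun_eq_iff)
  qed
  then have "h = s"
    by (auto simp: m_def fun_eq_iff)
  with s show ?thesis
    by simp
qed

end

section \<open>Invariants form a Laplacian subalgebra\<close>

lemma laplacian_subalgebra_Inter:
  assumes "\<T> \<noteq> {}" "\<And>T. T \<in> \<T> \<Longrightarrow> laplacian_subalgebra T"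
  shows "laplacian_subalgebra (\<Inter>\<T>)"
  using assms unfolding laplacian_subalgebra_def polynomial_subalgebra_def by blast

lemma orthonormal_basis_image:
  assumes "orthonormal_basis B" "orthogonal_transformation L" "surj L"
  shows "orthonormal_basis (L ` B)"
proof -
  have "span (L ` B) = UNIV"
    using assms linear_span_image[of L B] orthogonal_transformation_linear
    by (auto simp: orthonormal_basis_def)
  moreover have "pairwise orthogonal (L ` B)"
    using assms(1,2) unfolding orthonormal_basis_def pairwise_def orthogonal_def
      orthogonal_transformation_def by fastforce
  ultimately show ?thesis
    using assms(1,2) by (auto simp: orthonormal_basis_def orthogonal_transformation_norm)
qed

text \<open>
  An orthogonal map carries one orthonormal basis to another, and either one computes the Laplacian.
\<close>

lemma laplacian_compose_orthogonal:
  fixes B :: "'a::real_inner set" and L :: "'a \<Rightarrow> 'a"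
  assumes "orthonormal_basis B" "orthogonal_transformation L" "surj L" "poly_fun f"
    and "poly_fun (\<lambda>x. f (L x))"
  shows "laplacian f (L x) = laplacian (\<lambda>x. f (L x)) x"
proof -
  note L = orthogonal_transformation_linear[OF assms(2)]
  have "laplacian f (L x) = (\<Sum>c\<in>L ` B. \<partial> c (\<partial> c f) (L x))"
    by (simp add: laplacian_eq[OF orthonormal_basis_image[OF assms(1,2,3)] assms(4)])
  also have "\<dots> = (\<Sum>b\<in>B. \<partial> (L b) (\<partial> (L b) f) (L x))"
    using orthogonal_transformation_inj[OF assms(2)]
    by (subst sum.reindex) (auto intro: inj_on_subset)
  also have "\<dots> = laplacian (\<lambda>x. f (L x)) x"
    by (simp add: laplacian_eq[OF assms(1,5)] partial_derivative_compose_linear[OF L])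
  finally show ?thesis .
qed

lemma invariant_polynomials_laplacian_subalgebra:
  fixes B :: "'a::real_inner set" and \<sigma> :: "'g \<Rightarrow> 'a \<Rightarrow> 'a"
  assumes "orthonormal_basis B"
    and "\<And>g. g \<in> carrier G \<Longrightarrow> orthogonal_transformation (\<sigma> g)"
    and "\<And>g. g \<in> carrier G \<Longrightarrow> surj (\<sigma> g)"
  shows "laplacian_subalgebra (invariant_polynomials G \<sigma>)"
proof -
  have "laplacian f (\<sigma> g x) = laplacian f x"
    if f: "poly_fun f" "\<forall>g\<in>carrier G. \<forall>x. f (\<sigma> g x) = f x" and g: "g \<in> carrier G" for f g x
  proof -
    have "(\<lambda>x. f (\<sigma> g x)) = f"
      using f(2) g by blast
    then show ?thesis
      using laplacian_compose_orthogonal[OF assms(1) assms(2,3)[OF g] f(1)] f(1) by simp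
  qed
  moreover have "norm (\<sigma> g x) = norm x" if "g \<in> carrier G" for g x
    using assms(2)[OF that] by (rule orthogonal_transformation_norm)
  ultimately show ?thesis
    using laplacian_subalgebraD[OF laplacian_subalgebra_poly_fun[OF assms(1)]]
    by (auto simp: laplacian_subalgebra_def polynomial_subalgebra_def invariant_polynomials_def)
qed

section \<open>First polarizations\<close>

lemma partial_derivative_power:
  assumes "poly_fun p"
  shows "\<partial> u (\<lambda>x. p x ^ Suc m) = (\<lambda>x. real (Suc m) * p x ^ m * \<partial> u p x)"
proof (induction m)
  case (Suc m)
  have "\<partial> u (\<lambda>x. p x * p x ^ Suc m) = (\<lambda>x. \<partial> u p x * p x ^ Suc m + p x * \<partial> u (\<lambda>x. p x ^ Suc m) x)"
    using assms by (intro partial_derivative_mult) auto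
  then show ?case
    unfolding Suc.IH by (simp add: algebra_simps)
qed simp

text \<open>
  The gradient of \<open>v\<^sub>i \<bullet> v\<^sub>j\<close> is the linear vector field with \<open>v\<^sub>j\<close> in slot \<open>i\<close> and \<open>v\<^sub>i\<close> in slot \<open>j\<close>.
  A function of \<open>v\<^sub>i\<close> alone only sees slot \<open>i\<close>.
\<close>

lemma polarization_closed:
  fixes T :: "('a::real_inner ^ 'k::finite \<Rightarrow> real) set"
  assumes B: "orthonormal_basis (B :: ('a ^ 'k) set)"
    and T: "laplacian_subalgebra T" and "i \<noteq> j"
    and f: "(\<lambda>v. f (v $ i)) \<in> T" and ij: "(\<lambda>v. v $ i \<bullet> v $ j) \<in> T"
  shows "(\<lambda>v. \<partial> (v $ j) f (v $ i)) \<in> T"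
proof -
  let ?F = "\<lambda>v::'a ^ 'k. f (v $ i)" and ?w = "\<lambda>v::'a ^ 'k. axis i (v $ j) + axis j (v $ i)"
  have nth: "linear (\<lambda>v::'a ^ 'k. v $ l)" for l
    by (rule linearI) auto
  have "(\<Sum>b\<in>B. \<partial> b ?F v * \<partial> b (\<lambda>v. v $ i \<bullet> v $ j) v) = \<partial> (v $ j) f (v $ i)" for v
  proof -
    have "\<partial> b (\<lambda>v. v $ i \<bullet> v $ j) v = ?w v \<bullet> b" for b
      by (simp add: partial_derivative_inner_linear[OF nth nth] inner_add_left inner_add_right inner_commute
          inner_axis inner_axis')
    then have "(\<Sum>b\<in>B. \<partial> b ?F v * \<partial> b (\<lambda>v. v $ i \<bullet> v $ j) v) = \<partial> (?w v) ?F v"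
      by (simp add: partial_derivative_expand[OF B laplacian_subalgebraD(1)[OF T f], of "?w v"]
          mult.commute)
    also have "\<dots> = \<partial> (v $ j) f (v $ i)"
      using \<open>i \<noteq> j\<close> by (simp add: partial_derivative_compose_linear[OF nth] axis_def)
    finally show ?thesis .
  qed
  then show ?thesis
    using gradient_pairing_closed[OF B T f ij] by simp
qed

section \<open>Clearing denominators\<close>

text \<open>
  The module generated by \<open>T\<close> over the polynomials in the single variable \<open>v\<^sub>i\<close>. The form as a sum of
  products is what allows the coefficients to be averaged separately in \<open>span_average_closed\<close>.
\<close>

inductive_set first_variable_span ::
    "'k::finite \<Rightarrow> ('a::real_inner ^ 'k \<Rightarrow> real) set \<Rightarrow> ('a ^ 'k \<Rightarrow> real) set"
  for i :: 'k and T where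
  base: "poly_fun p \<Longrightarrow> b \<in> T \<Longrightarrow> (\<lambda>v. p (v $ i) * b v) \<in> first_variable_span i T"
| add: "r \<in> first_variable_span i T \<Longrightarrow> s \<in> first_variable_span i T \<Longrightarrow>
    (\<lambda>v. r v + s v) \<in> first_variable_span i T"

context
  fixes T :: "('a::real_inner ^ 'k::finite \<Rightarrow> real) set" and i :: 'k
  assumes T: "laplacian_subalgebra T"
begin

abbreviation "K \<equiv> first_variable_span i T"

lemma first_variable_span_poly: "poly_fun p \<Longrightarrow> (\<lambda>v. p (v $ i)) \<in> K"
  using first_variable_span.base[OF _ laplacian_subalgebraD(2)[OF T, of 1], of p i] by simp

lemma first_variable_span_superset: "b \<in> T \<Longrightarrow> b \<in> K"
  using first_variable_span.base[of "\<lambda>_. 1" b T i] by simp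

lemma first_variable_span_mult:
  assumes "r \<in> K" "s \<in> K"
  shows "(\<lambda>v. r v * s v) \<in> K"
  using assms(1)
proof (induction r rule: first_variable_span.induct)
  case (base p b)
  note pb = base
  show ?case
    using assms(2)
  proof (induction s rule: first_variable_span.induct)
    case (base q c)
    have "(\<lambda>v. (p (v $ i) * q (v $ i)) * (b v * c v)) \<in> K"
      using first_variable_span.base[of "\<lambda>x. p x * q x" "\<lambda>v. b v * c v" T i] pb base
        laplacian_subalgebraD(4)[OF T] by simp
    then show ?case
      by (simp add: mult_ac)
  next
    case (add r s)
    from first_variable_span.add[OF add(3,4)] show ?case
      by (simp add: algebra_simps)
  qed
next
  case (add r t)
  from first_variable_span.add[OF add(3,4)] show ?case
    by (simp add: algebra_simps)
qed

lemma first_variable_span_cmult: "r \<in> K \<Longrightarrow> (\<lambda>v. c * r v) \<in> K"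
  using first_variable_span_mult[OF first_variable_span_poly[of "\<lambda>_. c"]] by simp

lemma first_variable_span_diff:
  assumes "r \<in> K" "s \<in> K"
  shows "(\<lambda>v. r v - s v) \<in> K"
  using first_variable_span.add[OF assms(1) first_variable_span_cmult[OF assms(2), of "-1"]]
  by simp

text \<open>
  That is, \<open>h\<close> becomes an element of \<open>K\<close> after multiplication by a common denominator which depends on
  \<open>v\<^sub>i\<close> only.
\<close>

definition clearable :: "('a ^ 'k \<Rightarrow> real) \<Rightarrow> bool" where
  "clearable h \<longleftrightarrow> (\<exists>d. poly_fun d \<and> (\<exists>x. d x \<noteq> 0) \<and> (\<lambda>v. d (v $ i) * h v) \<in> K)"

lemma clearable_if_in_span: "h \<in> K \<Longrightarrow> clearable h"
  unfolding clearable_def by (intro exI[of _ "\<lambda>_. 1"]) simp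

lemma clearable_add_mult:
  assumes "clearable h1" "clearable h2"
  shows "clearable (\<lambda>v. h1 v + h2 v)" and "clearable (\<lambda>v. h1 v * h2 v)"
proof -
  obtain d1 d2 x y where d: "poly_fun d1" "poly_fun d2" "d1 x \<noteq> 0" "d2 y \<noteq> 0"
    and K1: "(\<lambda>v. d1 (v $ i) * h1 v) \<in> K" and K2: "(\<lambda>v. d2 (v $ i) * h2 v) \<in> K"
    using assms unfolding clearable_def by blast
  have D: "poly_fun (\<lambda>x. d1 x * d2 x)" "\<exists>x. d1 x * d2 x \<noteq> 0"
    using d poly_fun_no_zero_divisors by auto
  have "(\<lambda>v. d2 (v $ i) * (d1 (v $ i) * h1 v) + d1 (v $ i) * (d2 (v $ i) * h2 v)) \<in> K"
    by (intro first_variable_span.add first_variable_span_mult first_variable_span_poly d K1 K2)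
  then have "(\<lambda>v. (d1 (v $ i) * d2 (v $ i)) * (h1 v + h2 v)) \<in> K"
    by (simp add: algebra_simps)
  with D show "clearable (\<lambda>v. h1 v + h2 v)"
    unfolding clearable_def by (intro exI[of _ "\<lambda>x. d1 x * d2 x"]) simp
  from first_variable_span_mult[OF K1 K2]
  have "(\<lambda>v. (d1 (v $ i) * d2 (v $ i)) * (h1 v * h2 v)) \<in> K"
    by (simp add: mult_ac)
  with D show "clearable (\<lambda>v. h1 v * h2 v)"
    unfolding clearable_def by (intro exI[of _ "\<lambda>x. d1 x * d2 x"]) simp
qed

lemma clearable_sum:
  "finite J \<Longrightarrow> (\<And>j. j \<in> J \<Longrightarrow> clearable (h j)) \<Longrightarrow> clearable (\<lambda>v. \<Sum>j\<in>J. h j v)"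
proof (induction J rule: finite_induct)
  case empty
  show ?case
    using clearable_if_in_span[OF first_variable_span_poly[of "\<lambda>_. 0"]] by simp
next
  case (insert j J)
  then show ?case
    by (simp add: clearable_add_mult)
qed

end

section \<open>Polarizations generate all invariants\<close>

lemma diagonal_action_nth [simp]: "diagonal_action \<rho> g v $ j = \<rho> g (v $ j)"
  by (simp add: diagonal_action_def)

context
  fixes G :: "('g, 'm) monoid_scheme" and \<rho> :: "'g \<Rightarrow> 'a::real_inner \<Rightarrow> 'a"
  assumes fin: "finite (carrier G)" and rep: "orthogonal_representation G \<rho>"
begin

lemma orthogonal: "g \<in> carrier G \<Longrightarrow> orthogonal_transformation (\<rho> g)"
  using rep by (simp add: orthogonal_representation_def)

lemma action: "group_action G UNIV \<rho>"
  using rep by (simp add: orthogonal_representation_def)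

lemma group: "group G"
  using action by (simp add: group_action_def group_hom_def)

lemma action_surj: "g \<in> carrier G \<Longrightarrow> surj (\<rho> g)"
  using group_action.surj_prop[OF action] .

lemma action_mult:
  "g \<in> carrier G \<Longrightarrow> h \<in> carrier G \<Longrightarrow> \<rho> (g \<otimes>\<^bsub>G\<^esub> h) x = \<rho> g (\<rho> h x)"
  using group_action.composition_rule[OF action UNIV_I] .

lemma action_one: "\<rho> \<one>\<^bsub>G\<^esub> x = x"
  using fun_cong[OF group_action.id_eq_one[OF action], of x] by simp

lemma bij_betw_right_translation:
  assumes "h \<in> carrier G"
  shows "bij_betw (\<lambda>g. g \<otimes>\<^bsub>G\<^esub> h) (carrier G) (carrier G)"
proof -
  interpret group G
    by (rule group)
  show ?thesis
    by (rule bij_betwI[where g = "\<lambda>g. g \<otimes>\<^bsub>G\<^esub> inv\<^bsub>G\<^esub> h"]) (use assms in \<open>auto simp: m_assoc\<close>)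
qed

lemma sum_over_group_invariant:
  assumes "h \<in> carrier G"
  shows "(\<Sum>g\<in>carrier G. F (\<rho> g (\<rho> h x))) = (\<Sum>g\<in>carrier G. F (\<rho> g x))"
  using sum.reindex_bij_betw[OF bij_betw_right_translation[OF assms], of "\<lambda>g. F (\<rho> g x)"] assms
  by (simp add: action_mult)

lemma prod_over_group_invariant:
  fixes F :: "'a \<Rightarrow> real"
  assumes "h \<in> carrier G"
  shows "(\<Prod>g\<in>carrier G. F (\<rho> g (\<rho> h x))) = (\<Prod>g\<in>carrier G. F (\<rho> g x))"
  using prod.reindex_bij_betw[OF bij_betw_right_translation[OF assms], of "\<lambda>g. F (\<rho> g x)"] assms
  by (simp add: action_mult)

lemma bounded_linear_action:
  assumes "g \<in> carrier G"
  shows "bounded_linear (\<rho> g)"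
  using orthogonal_transformation_linear[OF orthogonal[OF assms]]
    orthogonal_transformation_norm[OF orthogonal[OF assms]]
  by (intro bounded_linear_intro[where K = 1]) (simp_all add: linear_add linear_scale)

lemma poly_fun_action:
  assumes "poly_fun p" "g \<in> carrier G"
  shows "poly_fun (\<lambda>x. p (\<rho> g x))"
  using poly_fun_compose_bounded_linear[OF assms(1) bounded_linear_action[OF assms(2)]] .

lemma group_average_invariant:
  assumes "poly_fun p"
  shows "(\<lambda>x. \<Sum>g\<in>carrier G. p (\<rho> g x)) \<in> invariant_polynomials G \<rho>"
  unfolding invariant_polynomials_def mem_Collect_eq
proof (intro conjI ballI allI)
  show "poly_fun (\<lambda>x. \<Sum>g\<in>carrier G. p (\<rho> g x))"
    using fin poly_fun_action[OF assms] by auto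
  show "(\<Sum>g\<in>carrier G. p (\<rho> g (\<rho> h x))) = (\<Sum>g\<in>carrier G. p (\<rho> g x))"
    if "h \<in> carrier G" for h x
    using that by (rule sum_over_group_invariant)
qed

lemma group_product_invariant:
  assumes "poly_fun p"
  shows "(\<lambda>x. \<Prod>g\<in>carrier G. p (\<rho> g x)) \<in> invariant_polynomials G \<rho>"
  unfolding invariant_polynomials_def mem_Collect_eq
proof (intro conjI ballI allI)
  show "poly_fun (\<lambda>x. \<Prod>g\<in>carrier G. p (\<rho> g x))"
    using fin poly_fun_action[OF assms] by auto
  show "(\<Prod>g\<in>carrier G. p (\<rho> g (\<rho> h x))) = (\<Prod>g\<in>carrier G. p (\<rho> g x))"
    if "h \<in> carrier G" for h x
    using that by (rule prod_over_group_invariant)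
qed

lemma orthogonal_diagonal_action:
  assumes "g \<in> carrier G"
  shows "orthogonal_transformation (diagonal_action \<rho> g :: 'a ^ 'k::finite \<Rightarrow> 'a ^ 'k)"
    and "surj (diagonal_action \<rho> g :: 'a ^ 'k::finite \<Rightarrow> 'a ^ 'k)"
proof -
  note o = orthogonal[OF assms]
  show "orthogonal_transformation (diagonal_action \<rho> g :: 'a ^ 'k \<Rightarrow> 'a ^ 'k)"
    unfolding orthogonal_transformation_def
  proof (intro conjI allI)
    show "linear (diagonal_action \<rho> g :: 'a ^ 'k \<Rightarrow> 'a ^ 'k)"
      using orthogonal_transformation_linear[OF o]
      by (intro linearI) (simp_all add: vec_eq_iff linear_add linear_scale)
    show "diagonal_action \<rho> g v \<bullet> diagonal_action \<rho> g w = v \<bullet> w" for v w :: "'a ^ 'k"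
      using o by (simp add: inner_vec_def orthogonal_transformation_def)
  qed
  show "surj (diagonal_action \<rho> g :: 'a ^ 'k \<Rightarrow> 'a ^ 'k)"
  proof (rule surjI)
    show "diagonal_action \<rho> g (\<chi> j. inv_into UNIV (\<rho> g) (v $ j)) = v" for v :: "'a ^ 'k"
      using surj_f_inv_f[OF action_surj[OF assms]] by (simp add: vec_eq_iff)
  qed
qed

context
  fixes T :: "('a ^ 'k::finite \<Rightarrow> real) set" and i :: 'k
  assumes basis: "\<exists>B :: 'a set. finite B \<and> span B = UNIV"
    and T: "laplacian_subalgebra T"
    and inv: "T \<subseteq> invariant_polynomials G (diagonal_action \<rho>)"
    and gen1: "\<And>f. f \<in> invariant_polynomials G \<rho> \<Longrightarrow> (\<lambda>v. f (v $ i)) \<in> T"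
    and gen2: "\<And>j. (\<lambda>v. v $ i \<bullet> v $ j) \<in> T"
begin

lemma poly_fun_linear_form:
  assumes "linear (\<theta> :: 'a \<Rightarrow> real)"
  shows "poly_fun \<theta>"
  using orthonormal_basis_exists[OF basis] bounded_linear_if_linear assms
  by (auto intro: real_polynomial_function.intros(1))

text \<open>
  Up to a constant factor this is the first polarization of the invariant \<open>\<Sum>\<^sub>g \<theta>(g x)\<^sup>m\<^sup>+\<^sup>1\<close>.
\<close>

lemma power_sum_polarization:
  assumes \<theta>: "linear \<theta>" and "i \<noteq> j"
  shows "(\<lambda>v. \<Sum>g\<in>carrier G. \<theta> (\<rho> g (v $ i)) ^ m * \<theta> (\<rho> g (v $ j))) \<in> T"
proof -
  obtain C :: "('a ^ 'k) set" where C: "orthonormal_basis C"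
    using orthonormal_basis_exists_vec[OF basis] ..
  have \<theta>g: "linear (\<lambda>x. \<theta> (\<rho> g x))" if "g \<in> carrier G" for g
    using linear_compose[OF orthogonal_transformation_linear[OF orthogonal[OF that]] \<theta>]
    by (simp add: o_def)
  note pf = poly_fun_linear_form[OF \<theta>g]
  let ?f = "\<lambda>x. \<Sum>g\<in>carrier G. \<theta> (\<rho> g x) ^ Suc m"
  have "(\<lambda>v. \<partial> (v $ j) ?f (v $ i)) \<in> T"
    using group_average_invariant[of "\<lambda>x. \<theta> x ^ Suc m"] poly_fun_linear_form[OF \<theta>]
    by (intro polarization_closed[OF C T \<open>i \<noteq> j\<close> gen1 gen2]) auto
  moreover have "\<partial> u ?f x = real (Suc m) * (\<Sum>g\<in>carrier G. \<theta> (\<rho> g x) ^ m * \<theta> (\<rho> g u))" for u x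
  proof -
    have "\<partial> u (\<lambda>x. \<theta> (\<rho> g x)) y = \<theta> (\<rho> g u)" if "g \<in> carrier G" for g y
      using partial_derivative_compose_linear[OF \<theta>g[OF that], of u "\<lambda>t. t"]
        partial_derivative_linear[OF bounded_linear_ident, of "\<theta> (\<rho> g u)"] by simp
    then have "\<partial> u ?f x = (\<Sum>g\<in>carrier G. real (Suc m) * \<theta> (\<rho> g x) ^ m * \<theta> (\<rho> g u))"
      using pf by (subst partial_derivative_sum) (auto simp: partial_derivative_power simp del: power_Suc)
    then show ?thesis
      by (simp add: sum_distrib_left mult.assoc)
  qed
  ultimately have "(\<lambda>v. real (Suc m) * (\<Sum>g\<in>carrier G. \<theta> (\<rho> g (v $ i)) ^ m * \<theta> (\<rho> g (v $ j)))) \<in> T"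
    by simp
  from laplacian_subalgebra_cmult[OF T this, of "1 / real (Suc m)"] show ?thesis
    by (simp add: mult.assoc[symmetric] del: of_nat_Suc)
qed

text \<open>
  The product over \<open>Q\<close> is a polynomial in the node \<open>\<theta>(g v\<^sub>i)\<close> whose coefficients are polynomials in
  \<open>v\<^sub>i\<close> independent of \<open>g\<close>. So the sum is a combination of power sum polarizations. The exponent \<open>m\<close> is free
  in order to absorb, one factor at a time, the node from each new factor.
\<close>

lemma interpolation_sum_in_span:
  assumes \<theta>: "linear \<theta>" and "i \<noteq> j" and "finite Q" "Q \<subseteq> carrier G"
  shows "(\<lambda>v. \<Sum>g\<in>carrier G. \<theta> (\<rho> g (v $ i)) ^ m *
            (\<Prod>q\<in>Q. \<theta> (\<rho> g (v $ i)) - \<theta> (\<rho> q (v $ i))) * \<theta> (\<rho> g (v $ j)))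
         \<in> first_variable_span i T"
  using assms(3,4)
proof (induction Q arbitrary: m rule: finite_induct)
  case empty
  show ?case
    using first_variable_span_superset[OF T power_sum_polarization[OF \<theta> \<open>i \<noteq> j\<close>]] by simp
next
  case (insert q Q)
  let ?P = "\<lambda>g v. \<Prod>q\<in>Q. \<theta> (\<rho> g (v $ i)) - \<theta> (\<rho> q (v $ i))"
  let ?S = "\<lambda>m v. \<Sum>g\<in>carrier G. \<theta> (\<rho> g (v $ i)) ^ m * ?P g v * \<theta> (\<rho> g (v $ j))"
  have q: "poly_fun (\<lambda>x. \<theta> (\<rho> q x))"
    using insert.prems poly_fun_action poly_fun_linear_form[OF \<theta>] by simp
  have S: "?S m \<in> first_variable_span i T" for m
    using insert.IH insert.prems by simp
  have "(\<lambda>v. ?S (Suc m) v - \<theta> (\<rho> q (v $ i)) * ?S m v) \<in> first_variable_span i T"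
    by (intro first_variable_span_diff[OF T] first_variable_span_mult[OF T] S
        first_variable_span_poly[OF T q])
  moreover have "?S (Suc m) v - \<theta> (\<rho> q (v $ i)) * ?S m v
      = (\<Sum>g\<in>carrier G. \<theta> (\<rho> g (v $ i)) ^ m *
          (\<Prod>q\<in>insert q Q. \<theta> (\<rho> g (v $ i)) - \<theta> (\<rho> q (v $ i))) * \<theta> (\<rho> g (v $ j)))" for v
    using insert.hyps by (simp add: sum_distrib_left sum_subtractf[symmetric] algebra_simps)
  ultimately show ?case
    by simp
qed

text \<open>
  The interpolation polynomial vanishes at all nodes \<open>\<theta>(q v\<^sub>i)\<close> with \<open>q \<in> Q\<close>. The group elements outside
  \<open>Q\<close> fix \<open>\<theta>\<close> and so contribute equal summands, which leaves a positive multiple of \<open>d(v\<^sub>i) \<theta>(v\<^sub>j)\<close>. The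
  denominator \<open>d\<close> is a product of nonzero linear forms, hence nonzero. Taking only those \<open>q\<close> that move
  \<open>\<theta>\<close> is what makes this work for representations that are not faithful.
\<close>

lemma linear_form_clearable:
  assumes \<theta>: "linear \<theta>"
  shows "clearable T i (\<lambda>v. \<theta> (v $ j))"
proof (cases "i = j")
  case True
  then show ?thesis
    using clearable_if_in_span[OF T first_variable_span_poly[OF T poly_fun_linear_form[OF \<theta>]]]
    by simp
next
  case False
  define Q where "Q = {g \<in> carrier G. \<exists>x. \<theta> (\<rho> g x) \<noteq> \<theta> x}"
  define d where "d = (\<lambda>x. \<Prod>q\<in>Q. \<theta> x - \<theta> (\<rho> q x))"
  have Q: "finite Q" "Q \<subseteq> carrier G"
    using fin by (auto simp: Q_def)
  have factor: "poly_fun (\<lambda>x. \<theta> x - \<theta> (\<rho> q x))" "\<exists>x. \<theta> x - \<theta> (\<rho> q x) \<noteq> 0" if "q \<in> Q" for q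
    using that poly_fun_linear_form[OF \<theta>] poly_fun_action[OF poly_fun_linear_form[OF \<theta>]]
    by (auto simp: Q_def) (metis eq_iff_diff_eq_0)
  have d: "poly_fun d" "\<exists>x. d x \<noteq> 0"
    unfolding d_def using Q(1) factor poly_fun_prod_nonzero[OF Q(1) factor] by auto
  have "\<one>\<^bsub>G\<^esub> \<in> carrier G - Q"
    using group.is_monoid[OF group] by (auto simp: Q_def action_one monoid.one_closed)
  then have card: "card (carrier G - Q) \<noteq> 0"
    using fin by auto
  have "(\<Sum>g\<in>carrier G. (\<Prod>q\<in>Q. \<theta> (\<rho> g x) - \<theta> (\<rho> q x)) * \<theta> (\<rho> g y))
      = real (card (carrier G - Q)) * (d x * \<theta> y)" for x y
  proof -
    have "(\<Sum>g\<in>carrier G. (\<Prod>q\<in>Q. \<theta> (\<rho> g x) - \<theta> (\<rho> q x)) * \<theta> (\<rho> g y))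
        = (\<Sum>g\<in>carrier G - Q. (\<Prod>q\<in>Q. \<theta> (\<rho> g x) - \<theta> (\<rho> q x)) * \<theta> (\<rho> g y))"
      using fin Q by (intro sum.mono_neutral_right) auto
    also have "\<dots> = (\<Sum>g\<in>carrier G - Q. d x * \<theta> y)"
      by (intro sum.cong) (auto simp: Q_def d_def)
    finally show ?thesis
      by simp
  qed
  then have "(\<lambda>v. real (card (carrier G - Q)) * (d (v $ i) * \<theta> (v $ j))) \<in> first_variable_span i T"
    using interpolation_sum_in_span[OF \<theta> False Q, of 0] by simp
  from first_variable_span_cmult[OF T this, of "1 / real (card (carrier G - Q))"]
  have "(\<lambda>v. d (v $ i) * \<theta> (v $ j)) \<in> first_variable_span i T"
    using card by (simp add: mult.assoc[symmetric])
  with d show ?thesis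
    unfolding clearable_def[OF T] by blast
qed

lemma poly_fun_clearable:
  assumes "poly_fun h"
  shows "clearable T i h"
  using assms
proof (induction h rule: real_polynomial_function.induct)
  case (linear h)
  have "linear (axis j :: 'a \<Rightarrow> 'a ^ 'k)" for j
    by (rule linearI) (auto simp: vec_eq_iff axis_def)
  from linear_compose[OF this bounded_linear.linear[OF linear]]
  have lin: "linear (\<lambda>x. h (axis j x))" for j
    by (simp add: o_def)
  have "h v = (\<Sum>j\<in>UNIV. h (axis j (v $ j)))" for v
  proof -
    have "v = (\<Sum>j\<in>UNIV. axis j (v $ j))"
      by (simp add: vec_eq_iff axis_def)
    then show ?thesis
      using linear_sum[OF bounded_linear.linear[OF linear]] by metis
  qed
  then have "h = (\<lambda>v. \<Sum>j\<in>UNIV. h (axis j (v $ j)))"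
    by blast
  moreover have "clearable T i (\<lambda>v. \<Sum>j\<in>UNIV. h (axis j (v $ j)))"
    using linear_form_clearable[OF lin] by (intro clearable_sum[OF T]) auto
  ultimately show ?case
    by simp
next
  case (const c)
  show ?case
    using clearable_if_in_span[OF T first_variable_span_poly[OF T, of "\<lambda>_. c"]] by simp
next
  case (add f g)
  then show ?case
    by (intro clearable_add_mult[OF T])
next
  case (mult f g)
  then show ?case
    by (intro clearable_add_mult[OF T])
qed

text \<open>
  The factors from \<open>T\<close> are invariant, so averaging acts only on the coefficients, and the average of a
  coefficient is an invariant of \<open>V\<close>.
\<close>

lemma span_average_closed:
  assumes "r \<in> first_variable_span i T"
  shows "(\<lambda>v. \<Sum>g\<in>carrier G. r (diagonal_action \<rho> g v)) \<in> T"
  using assms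
proof (induction r rule: first_variable_span.induct)
  case (base p b)
  have "(\<lambda>v. (\<Sum>g\<in>carrier G. p (\<rho> g (v $ i))) * b v) \<in> T"
    using gen1[OF group_average_invariant[OF base(1)]] base(2)
    by (intro laplacian_subalgebraD(4)[OF T])
  moreover have "b (diagonal_action \<rho> g v) = b v" if "g \<in> carrier G" for g v
    using inv base(2) that by (auto simp: invariant_polynomials_def)
  ultimately show ?case
    by (simp add: sum_distrib_right)
next
  case (add r s)
  from laplacian_subalgebraD(3)[OF T add(3,4)] show ?case
    by (simp add: sum.distrib)
qed

text \<open>
  Clear the denominator of \<open>h\<close>, make the denominator invariant, average, and divide by the denominator
  inside \<open>T\<close>.
\<close>

lemma invariant_polynomials_diagonal_subset:
  "invariant_polynomials G (diagonal_action \<rho>) \<subseteq> T"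
proof
  fix h :: "'a ^ 'k \<Rightarrow> real"
  assume "h \<in> invariant_polynomials G (diagonal_action \<rho>)"
  then have h: "poly_fun h" "\<And>g v. g \<in> carrier G \<Longrightarrow> h (diagonal_action \<rho> g v) = h v"
    by (auto simp: invariant_polynomials_def)
  obtain C :: "('a ^ 'k) set" where C: "orthonormal_basis C"
    using orthonormal_basis_exists_vec[OF basis] ..
  have one: "\<one>\<^bsub>G\<^esub> \<in> carrier G"
    using group.is_monoid[OF group] by (rule monoid.one_closed)
  obtain d x0 where d: "poly_fun d" "d x0 \<noteq> 0"
    and dh: "(\<lambda>v. d (v $ i) * h v) \<in> first_variable_span i T"
    using poly_fun_clearable[OF h(1)] unfolding clearable_def[OF T] by blast
  \<comment> \<open>The product of the translates of \<open>d\<close> is an invariant multiple of \<open>d\<close>.\<close>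
  define N where "N = (\<lambda>x. \<Prod>g\<in>carrier G. d (\<rho> g x))"
  have N: "N \<in> invariant_polynomials G \<rho>"
    unfolding N_def by (rule group_product_invariant[OF d(1)])
  have "\<exists>x. N x \<noteq> 0"
    unfolding N_def
  proof (rule poly_fun_prod_nonzero[OF fin])
    show "poly_fun (\<lambda>x. d (\<rho> g x))" if "g \<in> carrier G" for g
      using poly_fun_action[OF d(1) that] .
    show "\<exists>x. d (\<rho> g x) \<noteq> 0" if "g \<in> carrier G" for g
      using d(2) surjD[OF action_surj[OF that], of x0] by metis
  qed
  then obtain x1 where x1: "N x1 \<noteq> 0" ..
  define M where "M = (\<lambda>x. \<Prod>g\<in>carrier G - {\<one>\<^bsub>G\<^esub>}. d (\<rho> g x))"
  have "poly_fun M"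
    unfolding M_def using fin poly_fun_action[OF d(1)] by auto
  from first_variable_span_mult[OF T first_variable_span_poly[OF T this] dh]
  have "(\<lambda>v. (d (v $ i) * M (v $ i)) * h v) \<in> first_variable_span i T"
    by (simp add: mult_ac)
  moreover have "d x * M x = N x" for x
    using prod.remove[OF fin one, of "\<lambda>g. d (\<rho> g x)"] by (simp add: N_def M_def action_one)
  ultimately have "(\<lambda>v. N (v $ i) * h v) \<in> first_variable_span i T"
    by simp
  from span_average_closed[OF this]
  have "(\<lambda>v. real (card (carrier G)) * (N (v $ i) * h v)) \<in> T"
    using N by (simp add: h(2) invariant_polynomials_def)
  from laplacian_subalgebra_cmult[OF T this, of "1 / real (card (carrier G))"]
  have "(\<lambda>v. N (v $ i) * h v) \<in> T"
    using fin one by (auto simp: mult.assoc[symmetric] split: if_splits)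
  moreover have "(\<lambda>v::'a ^ 'k. N (v $ i)) \<noteq> (\<lambda>v. 0)"
    using x1 by (auto simp: fun_eq_iff intro!: exI[of _ "\<chi> j. x1"])
  ultimately show "h \<in> T"
    using laplacian_subalgebra_contains_quotients[OF C T h(1) gen1[OF N]] by blast
qed

end

end

theorem corollary5:
  fixes G :: "('g, 'm) monoid_scheme"
    and \<rho> :: "'g \<Rightarrow> 'a::real_inner \<Rightarrow> 'a"
    and i\<^sub>0 :: "'k::finite"
  assumes "\<exists>B :: 'a set. finite B \<and> span B = UNIV"
    and "finite (carrier G)"
    and "orthogonal_representation G \<rho>"
    and "CARD('k) \<ge> 2"
  shows "invariant_polynomials G (diagonal_action \<rho> :: 'g \<Rightarrow> 'a ^ 'k \<Rightarrow> 'a ^ 'k) =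
         generalized_polarizations i\<^sub>0 (invariant_polynomials G \<rho>)"
proof
  let ?C = "invariant_polynomials G (diagonal_action \<rho> :: 'g \<Rightarrow> 'a ^ 'k \<Rightarrow> 'a ^ 'k)"
  let ?gens = "{(\<lambda>v::'a ^ 'k. f (v $ i\<^sub>0)) | f. f \<in> invariant_polynomials G \<rho>} \<union>
    {(\<lambda>v::'a ^ 'k. (v $ i) \<bullet> (v $ j)) | i j. True}"
  obtain B :: "'a set" where B: "orthonormal_basis B"
    using orthonormal_basis_exists[OF assms(1)] ..
  obtain C :: "('a ^ 'k) set" where C: "orthonormal_basis C"
    using orthonormal_basis_exists_vec[OF assms(1)] ..
  have lap: "laplacian_subalgebra ?C"
    using invariant_polynomials_laplacian_subalgebra[OF C orthogonal_diagonal_action[OF assms(2,3)]] .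
  have "poly_fun (\<lambda>v::'a ^ 'k. (v $ i) \<bullet> (v $ j))" for i j
  proof -
    have "(v $ i) \<bullet> (v $ j) = (\<Sum>b\<in>B. (b \<bullet> v $ i) * (b \<bullet> v $ j))" for v :: "'a ^ 'k"
      using parseval[OF B] by simp
    moreover have "poly_fun (\<lambda>v::'a ^ 'k. b \<bullet> v $ l)" for b l
      by (intro real_polynomial_function.intros(1)
          bounded_linear_compose[OF bounded_linear_inner_right bounded_linear_vec_nth])
    ultimately show ?thesis
      using finite_basis[OF B] by simp
  qed
  then have gens: "?gens \<subseteq> ?C"
    using poly_fun_compose_bounded_linear[OF _ bounded_linear_vec_nth] orthogonal[OF assms(2,3)]
    by (auto simp: invariant_polynomials_def orthogonal_transformation_def)
  show sub: "generalized_polarizations i\<^sub>0 (invariant_polynomials G \<rho>) \<subseteq> ?C"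
    unfolding generalized_polarizations_def by (rule hull_minimal) (fact gens lap)+
  show "?C \<subseteq> generalized_polarizations i\<^sub>0 (invariant_polynomials G \<rho>)"
  proof (rule invariant_polynomials_diagonal_subset[OF assms(2,3,1) _ sub])
    show "laplacian_subalgebra (generalized_polarizations i\<^sub>0 (invariant_polynomials G \<rho>) :: ('a ^ 'k \<Rightarrow> real) set)"
      unfolding generalized_polarizations_def hull_def
      using gens lap by (intro laplacian_subalgebra_Inter) auto
    have hull: "?gens \<subseteq> generalized_polarizations i\<^sub>0 (invariant_polynomials G \<rho>)"
      unfolding generalized_polarizations_def by (rule hull_subset)
    show "(\<lambda>v. f (v $ i\<^sub>0)) \<in> generalized_polarizations i\<^sub>0 (invariant_polynomials G \<rho>)"
      if "f \<in> invariant_polynomials G \<rho>" for f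
      using that hull by blast
    show "(\<lambda>v. v $ i\<^sub>0 \<bullet> v $ j) \<in> generalized_polarizations i\<^sub>0 (invariant_polynomials G \<rho>)" for j
      using hull by blast
  qed
qed

end
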